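(* Assume that $f_{\mathcal H}$ is $L$-smooth and satisfies the PL condition with parameter $\mu>0$, that the honest local objectives satisfy the $(G,B)$-bounded dissimilarity condition, that the stochastic gradients satisfy the stochastic first-order oracle assumption with variance bound $\sigma^2$, that the aggregation rule $\mathcal A$ is $(b,\kappa)$-robust, and that $\kappa B^2<1/56$. Denote $$\alpha_4=\left(\tfrac38-21\kappa B^2\right)\mu,\qquad \alpha_5=\left(\frac{162L}{h}+756\kappa L\right)\sigma^2,\qquad \alpha_6=21\kappa G^2.$$ For any given integer $T>0$, suppose that the stepsizes are chosen as $$\gamma_t=\begin{cases}\gamma_0,& t<\lfloor T/2\rfloor,\\ \dfrac{2}{\alpha_4\left(s_0+t-\lfloor T/2\rfloor\right)},& t\ge\lfloor T/2\rfloor,\end{cases}$$ with $s_0>\max\{2,\frac{72L}{\alpha_4}\}$ and $\gamma_0=\frac{2}{\alpha_4s_0}<\min\{\frac1{\alpha_4},\frac1{36L}\}$, and that the momentum parameters are $\beta_t=1-36\gamma_tL$. Then the iterates generated by R-DSGD-M satisfy $$\mathbb E\left[f_{\mathcal H}(x^{T-1})-f_{\mathcal H}^*\right]\le(s_0-1)^2\left(f_{\mathcal H}(x^0)-f_{\mathcal H}^*\right)\frac{2\exp\left(-\alpha_4\gamma_0(\lfloor T/2\rfloor-1)\right)}{T^2}+\frac{2(\alpha_5\gamma_0+\alpha_6)(s_0-1)^2}{\alpha_4T^2}+\frac{4\alpha_5}{\alpha_4^2T}+\frac{\alpha_6}{\alpha_4}.$$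
   Context: Setting. There are $n$ workers and a central server; $b<n/2$ workers may be Byzantine. $\mathcal H\subset[n]=\{1,\dots,n\}$ is the set of honest workers, $|\mathcal H|=h=n-b$. Worker $i$ has data distribution $\mathcal D_i$ and, for a loss $\ell$, differentiable local objective $f_i(x)=\mathbb E_{\xi_i\sim\mathcal D_i}[\ell(x,\xi_i)]$, $x\in\mathbb R^d$. The global objective is $f_{\mathcal H}=\frac1h\sum_{i\in\mathcal H}f_i$, and $f_{\mathcal H}^*=\inf_{x\in\mathbb R^d}f_{\mathcal H}(x)>-\infty$. $\|\cdot\|$ is the Euclidean norm and $\mathbb E$ the total expectation. $\lfloor\cdot\rfloor$ is the floor function. R-DSGD-M (robust distributed SGD with local momentum). Given a deterministic $x^0\in\mathbb R^d$, $m_i^0=0$ for $i\in\mathcal H$, stepsizes $\gamma_t>0$, momentum parameters $\beta_t\in[0,1]$ and an aggregation rule $\mathcal A:\mathbb R^{d\times n}\to\mathbb R^d$: for $t=1,2,\dots$, each honest worker $i\in\mathcal H$ computes a stochastic gradient $g_i^t=g_i(x^{t-1},\xi_i^t)$, where $\xi_i^t\sim\mathcal D_i$ is drawn afresh (independently of the past), and sends $m_i^t=\beta_tm_i^{t-1}+(1-\beta_t)g_i^t$; each Byzantine worker $j$ sends an arbitrary vector $m_j^t\in\mathbb R^d$; the server sets $x^t=x^{t-1}-\gamma_t\,\mathcal A(m_1^t,\dots,m_n^t)$. $L$-smoothness: $f_{\mathcal H}$ is differentiable and $\nabla f_{\mathcal H}$ is Lipschitz continuous with constant $L>0$. PL condition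 with parameter $\mu>0$: $\|\nabla f_{\mathcal H}(x)\|^2\ge2\mu(f_{\mathcal H}(x)-f_{\mathcal H}^* )$ for all $x\in\mathbb R^d$. $(G,B)$-bounded dissimilarity ($G,B\ge0$): $\frac1h\sum_{i\in\mathcal H}\|\nabla f_i(x)-\nabla f_{\mathcal H}(x)\|^2\le G^2+B^2\|\nabla f_{\mathcal H}(x)\|^2$ for all $x\in\mathbb R^d$. Stochastic first-order oracle: for each $i\in\mathcal H$ and all $x$, $\mathbb E_{\xi_i\sim\mathcal D_i}[g_i(x,\xi_i)]=\nabla f_i(x)$ and $\mathbb E_{\xi_i\sim\mathcal D_i}[\|g_i(x,\xi_i)-\nabla f_i(x)\|^2]\le\sigma^2$; the stochastic gradients of different workers are mutually independent. $(b,\kappa)$-robustness ($\kappa>0$, $b<n/2$): for all $x_1,\dots,x_n\in\mathbb R^d$ and every $S\subset[n]$ with $|S|=n-b$, $\|\mathcal A(x_1,\dots,x_n)-\bar x_S\|^2\le\frac{\kappa}{n-b}\sum_{i\in S}\|x_i-\bar x_S\|^2$, where $\bar x_S=\frac1{n-b}\sum_{i\in S}x_i$. *)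

theory Defs
  imports "HOL-Probability.Probability"
begin

text \<open>
  The \<open>n\<close> workers are the elements of a finite index type \<open>'n\<close>, so that \<open>n = CARD('n)\<close>, and the
  tuple of vectors received by the server is an element of \<^typ>\<open>real ^ 'd ^ 'n\<close>.
  Throughout, \<open>H\<close> is the set of honest workers and \<open>h = card H\<close>.
\<close>

text \<open>Only meaningful where \<open>f\<close> is differentiable; there the vector \<open>D\<close> exists and is unique.\<close>

definition gradient :: "(real ^ 'd \<Rightarrow> real) \<Rightarrow> real ^ 'd \<Rightarrow> real ^ 'd" where
  "gradient f x = (THE D. GDERIV f x :> D)"

definition local_obj :: "('n \<Rightarrow> 's measure) \<Rightarrow> (real ^ 'd \<Rightarrow> 's \<Rightarrow> real) \<Rightarrow> 'n \<Rightarrow> real ^ 'd \<Rightarrow> real" where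
  "local_obj D l i x = (\<integral>s. l x s \<partial>D i)"

definition global_obj :: "'n set \<Rightarrow> ('n \<Rightarrow> real ^ 'd \<Rightarrow> real) \<Rightarrow> real ^ 'd \<Rightarrow> real" where
  "global_obj H f x = (1 / real (card H)) * (\<Sum>i\<in>H. f i x)"

definition smooth :: "real \<Rightarrow> (real ^ 'd \<Rightarrow> real) \<Rightarrow> bool" where
  "smooth L f \<longleftrightarrow> (\<forall>x. f differentiable (at x)) \<and> L-lipschitz_on UNIV (gradient f)"

definition PL_condition :: "real \<Rightarrow> (real ^ 'd \<Rightarrow> real) \<Rightarrow> bool" where
  "PL_condition \<mu> f \<longleftrightarrow> (\<forall>x. (norm (gradient f x))\<^sup>2 \<ge> 2 * \<mu> * (f x - (INF y. f y)))"

definition bounded_dissimilarity ::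
    "real \<Rightarrow> real \<Rightarrow> 'n set \<Rightarrow> ('n \<Rightarrow> real ^ 'd \<Rightarrow> real) \<Rightarrow> bool" where
  "bounded_dissimilarity G B H f \<longleftrightarrow>
     (\<forall>x. (1 / real (card H)) * (\<Sum>i\<in>H. (norm (gradient (f i) x - gradient (global_obj H f) x))\<^sup>2)
            \<le> G\<^sup>2 + B\<^sup>2 * (norm (gradient (global_obj H f) x))\<^sup>2)"

definition avg :: "'n::finite set \<Rightarrow> real ^ 'd ^ 'n \<Rightarrow> real ^ 'd" where
  "avg S X = (1 / real (card S)) *\<^sub>R (\<Sum>i\<in>S. X $ i)"

definition robust_aggregation ::
    "nat \<Rightarrow> real \<Rightarrow> (real ^ 'd ^ 'n \<Rightarrow> real ^ 'd) \<Rightarrow> bool" where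
  "robust_aggregation b \<kappa> A \<longleftrightarrow>
     (\<forall>X. \<forall>S :: 'n set. card S = CARD('n) - b \<longrightarrow>
        (norm (A X - avg S X))\<^sup>2
          \<le> \<kappa> / real (CARD('n) - b) * (\<Sum>i\<in>S. (norm (X $ i - avg S X))\<^sup>2))"

text \<open>
  In the following, \<open>\<xi> i t\<close> is the sample drawn by the honest worker \<open>i\<close> in round \<open>t \<ge> 1\<close>, and
  \<open>m t \<omega> $ i\<close> is the vector sent by worker \<open>i\<close> in round \<open>t\<close>.

  Integrability is part of the oracle assumption because the Bochner integral of a
  non-integrable function is 0 by convention. The joint measurability of \<open>g i\<close> makes
  the stochastic gradient at a random point a random variable.
\<close>

definition stochastic_oracle ::
    "'w measure \<Rightarrow> 'n set \<Rightarrow> ('n \<Rightarrow> 's measure) \<Rightarrow> ('n \<Rightarrow> real ^ 'd \<Rightarrow> real) \<Rightarrow>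
     ('n \<Rightarrow> real ^ 'd \<Rightarrow> 's \<Rightarrow> real ^ 'd) \<Rightarrow> real \<Rightarrow> ('n \<Rightarrow> nat \<Rightarrow> 'w \<Rightarrow> 's) \<Rightarrow> bool" where
  "stochastic_oracle M H D f g \<sigma> \<xi> \<longleftrightarrow>
     (\<forall>i\<in>H. (\<lambda>(x, s). g i x s) \<in> borel_measurable (borel \<Otimes>\<^sub>M D i)) \<and>
     (\<forall>i\<in>H. \<forall>x. integrable (D i) (g i x) \<and> (\<integral>s. g i x s \<partial>D i) = gradient (f i) x) \<and>
     (\<forall>i\<in>H. \<forall>x. integrable (D i) (\<lambda>s. (norm (g i x s - gradient (f i) x))\<^sup>2) \<and>
                 (\<integral>s. (norm (g i x s - gradient (f i) x))\<^sup>2 \<partial>D i) \<le> \<sigma>\<^sup>2) \<and>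
     (\<forall>t\<ge>1. \<forall>x. prob_space.indep_vars M (\<lambda>_. borel) (\<lambda>i \<omega>. g i x (\<xi> i t \<omega>)) H)"

text \<open>
  The samples of round \<open>t\<close> are, jointly over the honest workers, independent of the past, which
  consists of all samples drawn and all vectors sent in rounds \<open>1, \<dots>, t - 1\<close>. The vectors sent
  by Byzantine workers are arbitrary random vectors: those of round \<open>t\<close> may depend on everything
  up to and including round \<open>t\<close> (also on the samples and honest messages of round \<open>t\<close>), but not on
  samples that are yet to be drawn. Their measurability is contained in
  \<open>indep_set\<close>, which requires its arguments to consist of events.
\<close>

definition fresh_samples ::
    "'w measure \<Rightarrow> 'n set \<Rightarrow> ('n \<Rightarrow> 's measure) \<Rightarrow> ('n \<Rightarrow> nat \<Rightarrow> 'w \<Rightarrow> 's) \<Rightarrow>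
     (nat \<Rightarrow> 'w \<Rightarrow> real ^ 'd ^ 'n::finite) \<Rightarrow> bool" where
  "fresh_samples M H D \<xi> m \<longleftrightarrow>
     (\<forall>i\<in>H. \<forall>t\<ge>1. \<xi> i t \<in> M \<rightarrow>\<^sub>M D i \<and> distr M (D i) (\<xi> i t) = D i) \<and>
     (\<forall>t\<ge>1. prob_space.indep_set M
        (sets (vimage_algebra (space M) (\<lambda>\<omega>. \<lambda>r\<in>{1..<t}. (\<lambda>i\<in>H. \<xi> i r \<omega>, m r \<omega>))
                 (\<Pi>\<^sub>M r\<in>{1..<t}. (\<Pi>\<^sub>M i\<in>H. D i) \<Otimes>\<^sub>M borel)))
        (sets (vimage_algebra (space M) (\<lambda>\<omega>. \<lambda>i\<in>H. \<xi> i t \<omega>) (\<Pi>\<^sub>M i\<in>H. D i))))"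

text \<open>
  The iterates \<open>x\<close> and messages \<open>m\<close> form a run of the robust distributed SGD with local momentum.
  Nothing is required of \<open>m t \<omega> $ j\<close> for \<open>j \<notin> H\<close>.
\<close>

definition RDSGDM ::
    "'w measure \<Rightarrow> 'n set \<Rightarrow> (real ^ 'd ^ 'n \<Rightarrow> real ^ 'd) \<Rightarrow>
     ('n \<Rightarrow> real ^ 'd \<Rightarrow> 's \<Rightarrow> real ^ 'd) \<Rightarrow> (nat \<Rightarrow> real) \<Rightarrow> (nat \<Rightarrow> real) \<Rightarrow> real ^ 'd \<Rightarrow>
     ('n \<Rightarrow> nat \<Rightarrow> 'w \<Rightarrow> 's) \<Rightarrow> (nat \<Rightarrow> 'w \<Rightarrow> real ^ 'd) \<Rightarrow>
     (nat \<Rightarrow> 'w \<Rightarrow> real ^ 'd ^ 'n::finite) \<Rightarrow> bool" where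
  "RDSGDM M H A g \<gamma> \<beta> x0 \<xi> x m \<longleftrightarrow>
     (\<forall>\<omega>\<in>space M.
        x 0 \<omega> = x0 \<and> (\<forall>i\<in>H. m 0 \<omega> $ i = 0) \<and>
        (\<forall>t\<ge>1.
           (\<forall>i\<in>H. m t \<omega> $ i =
              \<beta> t *\<^sub>R (m (t - 1) \<omega> $ i) + (1 - \<beta> t) *\<^sub>R g i (x (t - 1) \<omega>) (\<xi> i t \<omega>)) \<and>
           x t \<omega> = x (t - 1) \<omega> - \<gamma> t *\<^sub>R A (m t \<omega>)))"

end

theory Submission
  imports Defs
begin

text \<open>
  The proof rests on one Lyapunov function. In round \<open>t\<close>, let \<open>V t\<close> be the optimality gap at
  \<open>x (t - 1)\<close>, plus \<open>1 / (8 * L)\<close> times the squared distance between the average honest momentum of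
  round \<open>t\<close> and the gradient at \<open>x (t - 1)\<close>, plus \<open>7 * \<kappa> / (12 * L)\<close> times the mean squared
  deviation of the honest momenta from their average. The last quantity controls, by robustness, the
  distance between the aggregate and the average honest momentum. In expectation, \<open>V (t + 1)\<close> is at
  most \<open>(1 - 2 * \<alpha>4 * \<gamma> t) * V t + \<alpha>6 * \<gamma> t + \<alpha>5 * (\<gamma> t)\<^sup>2\<close>.

  A round consists of two halves. Averaging over the fresh samples, with the past frozen, replaces
  \<open>V\<close> by a deterministic function \<open>drift\<close> of the state, plus a variance (\<open>lyapunov_noise_step\<close>). For
  the server step there is a pointwise estimate: \<open>drift\<close> after the step is at most
  \<open>1 - 2 * \<alpha>4 * \<gamma>\<close> times \<open>V\<close> before it, plus a bias (\<open>drift_step\<close>). It holds for every value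
  of the Byzantine messages, so nothing about their law enters.

  Initially \<open>V\<close> is at most \<open>5 / 4\<close> of the gap at \<open>x0\<close> up to noise and bias (\<open>drift_initial\<close>). The
  scalar recursion is solved in \<open>two_phase_recursion_bound\<close>. Its rate \<open>2 * \<alpha>4\<close> is twice the one in
  the exponential of the claim; the surplus lets the decreasing step sizes damp the past like
  \<open>s ^ (-4)\<close> instead of \<open>s ^ (-2)\<close>, which pays for the factor \<open>5 / 4\<close> and yields the stated constants.
  Finally the gap at \<open>x (T - 1)\<close> is at most \<open>V T\<close>.
\<close>

section \<open>Gradients of smooth functions\<close>

lemma gderiv_gradient:
  fixes f :: "real ^ 'd \<Rightarrow> real"
  assumes "f differentiable (at x)"
  shows "GDERIV f x :> gradient f x"
proof -
  obtain f' where f': "(f has_derivative f') (at x)"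
    using assms by (auto simp: differentiable_def)
  define D where "D = (\<Sum>b\<in>Basis. f' b *\<^sub>R b)"
  have "f' = (\<lambda>h. inner h D)"
  proof
    fix h
    have lin: "linear f'" using f' by (rule has_derivative_linear)
    have "f' h = f' (\<Sum>b\<in>Basis. inner h b *\<^sub>R b)" by (simp add: euclidean_representation)
    also have "\<dots> = (\<Sum>b\<in>Basis. inner h b * f' b)"
      by (simp add: linear_sum[OF lin] linear_scale[OF lin])
    finally show "f' h = inner h D"
      by (simp add: D_def inner_sum_right inner_scaleR_right mult.commute)
  qed
  then have ex: "GDERIV f x :> D" using f' by (simp add: gderiv_def)
  have "D' = D" if "GDERIV f x :> D'" for D'
    using that ex has_derivative_unique[of f] unfolding gderiv_def
    by (metis vector_eq_ldot)
  then show ?thesis unfolding gradient_def using ex by (rule_tac theI) auto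
qed

lemma gradient_eqI:
  fixes f :: "real ^ 'd \<Rightarrow> real"
  assumes "GDERIV f x :> D"
  shows "gradient f x = D"
proof -
  have "f differentiable (at x)" using assms by (auto simp: gderiv_def differentiable_def)
  from gderiv_gradient[OF this] assms show ?thesis unfolding gderiv_def
    by (metis has_derivative_unique vector_eq_ldot)
qed

lemma gradient_global_obj:
  fixes f :: "'n \<Rightarrow> real ^ 'd \<Rightarrow> real"
  assumes "\<And>i. i \<in> H \<Longrightarrow> f i differentiable (at x)"
  shows "gradient (global_obj H f) x = (1 / real (card H)) *\<^sub>R (\<Sum>i\<in>H. gradient (f i) x)"
proof (rule gradient_eqI)
  have "((\<lambda>x. (1 / real (card H)) * (\<Sum>i\<in>H. f i x)) has_derivative
         (\<lambda>h. (1 / real (card H)) * (\<Sum>i\<in>H. inner h (gradient (f i) x)))) (at x)"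
    using gderiv_gradient[OF assms] unfolding gderiv_def
    by (intro has_derivative_mult_right has_derivative_sum) auto
  then show "GDERIV (global_obj H f) x :> (1 / real (card H)) *\<^sub>R (\<Sum>i\<in>H. gradient (f i) x)"
    by (simp add: gderiv_def global_obj_def[abs_def] inner_sum_right)
qed

lemma smooth_norm_gradient_diff:
  assumes "smooth L \<phi>"
  shows "norm (gradient \<phi> y - gradient \<phi> x) \<le> L * norm (y - x)"
  using assms lipschitz_onD[of L UNIV "gradient \<phi>" y x] by (simp add: smooth_def dist_norm)

text \<open>
  Along the segment from \<open>x\<close> to \<open>y\<close>, the difference of the two sides has derivative at most 0, by
  the Cauchy-Schwarz inequality and the Lipschitz bound on the gradient.
\<close>

lemma smooth_upper_bound:
  assumes "smooth L \<phi>"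
  shows "\<phi> y \<le> \<phi> x + inner (gradient \<phi> x) (y - x) + L / 2 * (norm (y - x))\<^sup>2"
proof -
  define v where "v = y - x"
  define \<psi> where "\<psi> s = \<phi> (x + s *\<^sub>R v) - s * inner (gradient \<phi> x) v - L / 2 * s\<^sup>2 * (norm v)\<^sup>2" for s
  define \<psi>' where "\<psi>' s = inner (gradient \<phi> (x + s *\<^sub>R v)) v - inner (gradient \<phi> x) v - L * s * (norm v)\<^sup>2"
    for s
  have der: "(\<psi> has_real_derivative \<psi>' s) (at s)" for s
  proof -
    have "GDERIV \<phi> (x + s *\<^sub>R v) :> gradient \<phi> (x + s *\<^sub>R v)"
      using assms by (intro gderiv_gradient) (simp add: smooth_def)
    then have "(\<phi> has_derivative (\<lambda>h. inner h (gradient \<phi> (x + s *\<^sub>R v)))) (at (x + s *\<^sub>R v))"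
      by (simp add: gderiv_def)
    moreover have "((\<lambda>s. x + s *\<^sub>R v) has_derivative (\<lambda>h. h *\<^sub>R v)) (at s)"
      by (auto intro!: derivative_eq_intros)
    ultimately have "((\<lambda>s. \<phi> (x + s *\<^sub>R v)) has_derivative
        (\<lambda>h. inner (h *\<^sub>R v) (gradient \<phi> (x + s *\<^sub>R v)))) (at s)"
      by (rule has_derivative_compose[rotated])
    then have "((\<lambda>s. \<phi> (x + s *\<^sub>R v)) has_real_derivative inner (gradient \<phi> (x + s *\<^sub>R v)) v) (at s)"
      by (simp add: has_field_derivative_def inner_commute mult.commute[of _ "inner _ _"])
    then show ?thesis unfolding \<psi>_def[abs_def] \<psi>'_def
      by (auto intro!: derivative_eq_intros simp: algebra_simps)
  qed
  have "\<psi>' s \<le> 0" if "0 \<le> s" for s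
  proof -
    have "inner (gradient \<phi> (x + s *\<^sub>R v) - gradient \<phi> x) v
        \<le> norm (gradient \<phi> (x + s *\<^sub>R v) - gradient \<phi> x) * norm v"
      by (rule norm_cauchy_schwarz)
    also have "\<dots> \<le> (L * norm (s *\<^sub>R v)) * norm v"
      using smooth_norm_gradient_diff[OF assms, of "x + s *\<^sub>R v" x] by (intro mult_right_mono) auto
    finally show ?thesis using that
      by (simp add: \<psi>'_def inner_diff_left power2_eq_square mult.assoc)
  qed
  then have "\<psi> 1 \<le> \<psi> 0"
    by (intro DERIV_nonpos_imp_nonincreasing[of 0 1 \<psi>]) (use der in auto)
  then show ?thesis by (simp add: \<psi>_def v_def)
qed

text \<open>
  One gradient step of length \<open>1 / L\<close> decreases \<open>\<phi>\<close> by at least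
  \<open>(norm (gradient \<phi> x))\<^sup>2 / (2 * L)\<close>, and \<open>\<phi>\<close> cannot fall below \<open>c\<close>. Together with the
  PL condition this forces \<open>\<mu> \<le> L\<close> for every function that is not constantly equal to its infimum.
\<close>

lemma smooth_gradient_bound:
  assumes "smooth L \<phi>" "L > 0" "\<And>y. c \<le> \<phi> y"
  shows "(norm (gradient \<phi> x))\<^sup>2 \<le> 2 * L * (\<phi> x - c)"
proof -
  have "c \<le> \<phi> (x - (1 / L) *\<^sub>R gradient \<phi> x)" by (rule assms)
  also have "\<dots> \<le> \<phi> x - (1 / L) * (norm (gradient \<phi> x))\<^sup>2 + L / 2 * ((1 / L) * norm (gradient \<phi> x))\<^sup>2"
    using smooth_upper_bound[OF assms(1), of "x - (1 / L) *\<^sub>R gradient \<phi> x" x] \<open>L > 0\<close>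
    by (simp add: power2_norm_eq_inner)
  also have "\<dots> = \<phi> x - (norm (gradient \<phi> x))\<^sup>2 / (2 * L)"
    using \<open>L > 0\<close> by (simp add: field_simps power2_eq_square)
  finally show ?thesis using \<open>L > 0\<close> by (simp add: field_simps)
qed

lemma continuous_on_smooth:
  assumes "smooth L \<phi>"
  shows "continuous_on UNIV \<phi>"
  using assms
  by (auto simp: smooth_def intro!: differentiable_imp_continuous_on differentiable_at_imp_differentiable_on)

lemma continuous_on_gradient:
  assumes "smooth L \<phi>"
  shows "continuous_on UNIV (gradient \<phi>)"
  using assms by (auto simp: smooth_def intro: lipschitz_on_continuous_on)

lemma norm_add_sq_le:
  fixes u v :: "'a :: real_inner"
  assumes "c > 0"
  shows "(norm (u + v))\<^sup>2 \<le> (1 + c) * (norm u)\<^sup>2 + (1 + 1 / c) * (norm v)\<^sup>2"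
proof -
  have "0 \<le> (norm (c *\<^sub>R u - v))\<^sup>2 / c" using assms by simp
  also have "\<dots> = c * (norm u)\<^sup>2 - 2 * inner u v + (norm v)\<^sup>2 / c"
    using assms by (simp add: power2_norm_eq_inner inner_diff_left inner_diff_right inner_commute field_simps)
  finally show ?thesis
    by (simp add: power2_norm_eq_inner inner_add_left inner_add_right inner_commute algebra_simps)
qed

section \<open>The Lyapunov function and its decrease along a server step\<close>

definition spread :: "'n::finite set \<Rightarrow> real ^ 'd ^ 'n \<Rightarrow> real" where
  "spread H m = (1 / real (card H)) * (\<Sum>i\<in>H. (norm (m $ i - avg H m))\<^sup>2)"

text \<open>
  Paired with the iterate \<open>x\<close> is the message tuple \<open>m\<close> formed from gradients at \<open>x\<close>. The second
  term is the error of the averaged momentum as an estimate of the gradient; the third bounds the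
  error of the aggregation through robustness. The weights balance the descent inequality: with
  \<open>1 - \<beta> = 36 * \<gamma> * L\<close> both errors shrink by an amount of order \<open>\<gamma>\<close> that exceeds what they
  contribute to the descent step, and the noise entering them, \<open>(1 - \<beta>)\<^sup>2 * \<sigma>\<^sup>2\<close> with factors
  \<open>1 / (8 * L * h)\<close> and \<open>7 * \<kappa> / (12 * L)\<close>, is exactly \<open>\<alpha>5 * \<gamma>\<^sup>2\<close>.
\<close>

definition lyapunov :: "'n::finite set \<Rightarrow> (real ^ 'd \<Rightarrow> real) \<Rightarrow> real \<Rightarrow> real \<Rightarrow> real \<Rightarrow>
    real ^ 'd \<Rightarrow> real ^ 'd ^ 'n \<Rightarrow> real" where
  "lyapunov H \<phi> c L \<kappa> x m =
     (\<phi> x - c) + (norm (avg H m - gradient \<phi> x))\<^sup>2 / (8 * L) + 7 * \<kappa> / (12 * L) * spread H m"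

text \<open>
  The noise-free part of the expected Lyapunov value after one momentum update at \<open>x\<close> starting from
  the messages \<open>m\<close>, with the dissimilarity of the local gradients replaced by its bound.
\<close>

definition drift :: "'n::finite set \<Rightarrow> (real ^ 'd \<Rightarrow> real) \<Rightarrow> real \<Rightarrow> real \<Rightarrow> real \<Rightarrow> real \<Rightarrow> real \<Rightarrow>
    real \<Rightarrow> real ^ 'd \<Rightarrow> real ^ 'd ^ 'n \<Rightarrow> real" where
  "drift H \<phi> c L \<kappa> G B \<beta> x m =
     (\<phi> x - c) + \<beta>\<^sup>2 * (norm (avg H m - gradient \<phi> x))\<^sup>2 / (8 * L)
     + 7 * \<kappa> / (12 * L) * (\<beta> * spread H m + (1 - \<beta>) * (G\<^sup>2 + B\<^sup>2 * (norm (gradient \<phi> x))\<^sup>2))"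

lemma spread_nonneg: "0 \<le> spread H m"
  by (simp add: spread_def sum_nonneg)

lemma lyapunov_nonneg:
  assumes "c \<le> \<phi> x" "L > 0" "\<kappa> \<ge> 0"
  shows "0 \<le> lyapunov H \<phi> c L \<kappa> x m"
  unfolding lyapunov_def using assms
  by (intro add_nonneg_nonneg mult_nonneg_nonneg divide_nonneg_nonneg spread_nonneg) auto

text \<open>
  The deterministic half of the contraction: the server step from \<open>x\<close> followed by the noise-free
  momentum update. Writing \<open>-2 \<langle>p, R\<rangle> = |R - p|\<^sup>2 - |p|\<^sup>2 - |R|\<^sup>2\<close> for the gradient \<open>p\<close> and the
  aggregate \<open>R\<close>, the term \<open>- \<gamma> / 2 * |R|\<^sup>2\<close> pays for the change of the gradient between two
  iterates. Of \<open>- \<gamma> / 2 * |p|\<^sup>2\<close>, the dissimilarity at the new iterate consumes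
  \<open>21 * \<kappa> * B\<^sup>2 * \<gamma> * |p|\<^sup>2\<close> and a small remainder, and PL turns the rest into a
  contraction of the objective. The rate obtained is \<open>2 * \<alpha>\<close>, twice the rate visible in the final
  bound; the surplus is spent in the step-size recursion.
\<close>

lemma drift_step:
  fixes A :: "real ^ 'd ^ 'n \<Rightarrow> real ^ 'd" and H :: "'n::finite set"
  assumes smooth: "smooth L \<phi>" and "L > 0"
    and PL: "\<And>y. 2 * \<mu> * (\<phi> y - c) \<le> (norm (gradient \<phi> y))\<^sup>2" and lower: "\<And>y. c \<le> \<phi> y"
    and "0 < \<mu>" "\<mu> \<le> L"
    and "\<kappa> > 0" and robust: "robust_aggregation b \<kappa> A" and cardH: "card H = CARD('n) - b"
    and kB: "\<kappa> * B\<^sup>2 < 1 / 56"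
    and \<alpha>: "\<alpha> = (3 / 8 - 21 * \<kappa> * B\<^sup>2) * \<mu>"
    and "\<gamma> > 0" "36 * L * \<gamma> \<le> 1" "\<gamma>' \<le> \<gamma>" "2 / 3 * \<gamma> \<le> \<gamma>'"
  shows "drift H \<phi> c L \<kappa> G B (1 - 36 * \<gamma>' * L) (x - \<gamma> *\<^sub>R A m) m
    \<le> (1 - 2 * \<alpha> * \<gamma>) * lyapunov H \<phi> c L \<kappa> x m + 21 * \<kappa> * G\<^sup>2 * \<gamma>'"
proof -
  define x' where "x' = x - \<gamma> *\<^sub>R A m"
  define p where "p = gradient \<phi> x"
  define p' where "p' = gradient \<phi> x'"
  define a where "a = avg H m"
  define r where "r = (norm (A m))\<^sup>2"
  define d where "d = (norm (a - p))\<^sup>2"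
  define d' where "d' = (norm (a - p'))\<^sup>2"
  define P where "P = (norm p)\<^sup>2"
  define P' where "P' = (norm p')\<^sup>2"
  define S where "S = spread H m"
  define F where "F = \<phi> x - c"
  define F' where "F' = \<phi> x' - c"
  define q where "q = 21 * \<kappa> * B\<^sup>2"
  define y where "y = L * \<gamma>"
  define \<beta> where "\<beta> = 1 - 36 * \<gamma>' * L"
  have q: "0 \<le> q" "q < 3 / 8" using kB \<open>\<kappa> > 0\<close> by (auto simp: q_def)
  have y: "0 < y" "y \<le> 1 / 36" using \<open>L > 0\<close> \<open>\<gamma> > 0\<close> \<open>36 * L * \<gamma> \<le> 1\<close> by (auto simp: y_def)
  have nonneg: "0 \<le> r" "0 \<le> d" "0 \<le> P" "0 \<le> S" "0 \<le> F" "0 \<le> d'" "0 \<le> P'"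
    using lower spread_nonneg by (auto simp: r_def d_def P_def S_def F_def d'_def P'_def)
  have y': "L * \<gamma>' \<le> y" "2 / 3 * y \<le> L * \<gamma>'"
    using \<open>L > 0\<close> assms(14,15) mult_left_mono[of "2/3 * \<gamma>" \<gamma>' L] by (auto simp: y_def)
  have \<beta>: "0 \<le> \<beta>" "\<beta> \<le> 1 - 24 * y" "1 - \<beta> = 36 * \<gamma>' * L"
    using y y' by (auto simp: \<beta>_def mult.commute)
  have \<alpha>4: "0 < \<alpha>" "2 * \<alpha> \<le> 3 / 4 * L" "\<alpha> = (3 / 8 - q) * \<mu>"
  proof -
    show *: "\<alpha> = (3 / 8 - q) * \<mu>" by (simp add: \<alpha> q_def)
    then show "0 < \<alpha>" using q \<open>\<mu> > 0\<close> by simp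
    have "(3 / 8 - q) * \<mu> \<le> 3 / 8 * L" using q \<open>\<mu> \<le> L\<close> \<open>0 < \<mu>\<close> by (intro mult_mono) auto
    then show "2 * \<alpha> \<le> 3 / 4 * L" by (simp add: *)
  qed
  have rob: "(norm (A m - a))\<^sup>2 \<le> \<kappa> * S"
    using robust cardH by (simp add: robust_aggregation_def a_def S_def spread_def)
  have "norm (p' - p) \<le> L * norm (x' - x)"
    unfolding p_def p'_def by (rule smooth_norm_gradient_diff[OF smooth])
  then have "norm (p' - p) \<le> y * norm (A m)" using \<open>\<gamma> > 0\<close> by (simp add: x'_def y_def)
  then have pp: "(norm (p' - p))\<^sup>2 \<le> y\<^sup>2 * r"
    using power_mono[of "norm (p' - p)" "y * norm (A m)" 2] by (simp add: r_def power_mult_distrib)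
  have "(norm (A m - p))\<^sup>2 \<le> 3 * d + 3 / 2 * (\<kappa> * S)"
    using norm_add_sq_le[of 2 "a - p" "A m - a"] rob by (simp add: d_def)
  moreover have "\<phi> x' \<le> \<phi> x - \<gamma> * inner p (A m) + L / 2 * \<gamma>\<^sup>2 * r"
    using smooth_upper_bound[OF smooth, of x' x] \<open>\<gamma> > 0\<close>
    by (simp add: x'_def p_def r_def power_mult_distrib)
  moreover have "2 * inner p (A m) = P + r - (norm (A m - p))\<^sup>2"
    by (simp add: P_def r_def power2_norm_eq_inner inner_diff_left inner_diff_right inner_commute)
  ultimately have "F' \<le> F - \<gamma> * ((P + r - (3 * d + 3 / 2 * (\<kappa> * S))) / 2) + y / 2 * (\<gamma> * r)"
  proof -
    assume *: "(norm (A m - p))\<^sup>2 \<le> 3 * d + 3 / 2 * (\<kappa> * S)"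
      "\<phi> x' \<le> \<phi> x - \<gamma> * inner p (A m) + L / 2 * \<gamma>\<^sup>2 * r"
      "2 * inner p (A m) = P + r - (norm (A m - p))\<^sup>2"
    have "\<gamma> * ((P + r - (3 * d + 3 / 2 * (\<kappa> * S))) / 2) \<le> \<gamma> * inner p (A m)"
      using * \<open>\<gamma> > 0\<close> by (intro mult_left_mono) auto
    with *(2) show ?thesis by (simp add: F'_def F_def y_def power2_eq_square mult_ac)
  qed
  moreover have "y / 2 * (\<gamma> * r) \<le> 1 / 72 * (\<gamma> * r)"
    using y nonneg \<open>\<gamma> > 0\<close> by (intro mult_right_mono) auto
  ultimately have descent: "F' \<le> F - \<gamma> * P / 2 - 35 / 72 * (\<gamma> * r) + 3 / 2 * (\<gamma> * d) + 3 / 4 * (\<gamma> * (\<kappa> * S))"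
  proof -
    assume *: "F' \<le> F - \<gamma> * ((P + r - (3 * d + 3 / 2 * (\<kappa> * S))) / 2) + y / 2 * (\<gamma> * r)"
      "y / 2 * (\<gamma> * r) \<le> 1 / 72 * (\<gamma> * r)"
    have "\<gamma> * ((P + r - (3 * d + 3 / 2 * (\<kappa> * S))) / 2)
        = \<gamma> * P / 2 + \<gamma> * r / 2 - 3 / 2 * (\<gamma> * d) - 3 / 4 * (\<gamma> * (\<kappa> * S))"
      by (simp add: field_simps)
    with * show ?thesis by linarith
  qed
  \<comment> \<open>Splitting with weight \<open>y\<close> leaves most of the contraction \<open>1 - 24 y\<close> of the momentum and
    costs \<open>1 / 8 * (\<gamma> * r)\<close>, which the descent can pay.\<close>
  have "d' \<le> (1 + y) * d + (1 + 1 / y) * (y\<^sup>2 * r)"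
  proof -
    have "d' \<le> (1 + y) * d + (1 + 1 / y) * (norm (p - p'))\<^sup>2"
      using norm_add_sq_le[of y "a - p" "p - p'"] y by (simp add: d_def d'_def)
    also have "\<dots> \<le> (1 + y) * d + (1 + 1 / y) * (y\<^sup>2 * r)"
      using pp y by (intro add_left_mono mult_left_mono) (auto simp: norm_minus_commute)
    finally show ?thesis .
  qed
  also have "\<dots> = (1 + y) * d + (1 + y) * (y * r)"
    using y by (simp add: field_simps power2_eq_square)
  finally have d'_le: "d' \<le> (1 + y) * d + (1 + y) * (y * r)" .
  have "\<beta>\<^sup>2 * d' \<le> (1 - 24 * y) * d'"
    using \<beta> y nonneg mult_mono[of \<beta> 1 \<beta> "1 - 24 * y"] by (intro mult_right_mono) (auto simp: power2_eq_square)
  also have "\<dots> \<le> (1 - 24 * y) * ((1 + y) * d + (1 + y) * (y * r))"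
    using d'_le y by (intro mult_left_mono) auto
  also have "\<dots> = ((1 - 24 * y) * (1 + y)) * (d + y * r)" by (simp add: algebra_simps)
  also have "\<dots> = (1 - 23 * y - 24 * y\<^sup>2) * d + (1 - 23 * y - 24 * y\<^sup>2) * (y * r)"
    by (simp add: algebra_simps power2_eq_square)
  also have "\<dots> \<le> (1 - 23 * y) * d + 1 * (y * r)"
  proof -
    have "0 \<le> y\<^sup>2" by simp
    then have "1 - 23 * y - 24 * y\<^sup>2 \<le> 1" "1 - 23 * y - 24 * y\<^sup>2 \<le> 1 - 23 * y"
      using y by linarith+
    moreover have "0 \<le> y * r" using y nonneg by simp
    ultimately show ?thesis using nonneg(2) by (intro add_mono mult_right_mono)
  qed
  finally have "\<beta>\<^sup>2 * d' / (8 * L) \<le> ((1 - 23 * y) * d + y * r) / (8 * L)"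
    using \<open>L > 0\<close> by (intro divide_right_mono) auto
  also have "\<dots> = d / (8 * L) - 23 / 8 * (\<gamma> * d) + 1 / 8 * (\<gamma> * r)"
    using \<open>L > 0\<close> by (simp add: y_def field_simps)
  finally have momentum: "\<beta>\<^sup>2 * d' / (8 * L) \<le> d / (8 * L) - 23 / 8 * (\<gamma> * d) + 1 / 8 * (\<gamma> * r)" .
  \<comment> \<open>The dissimilarity is bounded at \<open>x'\<close>, so its gradient must be brought back to \<open>x\<close>; since
    \<open>q < 3 / 8\<close>, the factor \<open>4 / 3\<close> costs at most \<open>1 / 8\<close> of \<open>\<gamma> * P\<close>.\<close>
  have "P' \<le> 4 / 3 * P + 4 * (y\<^sup>2 * r)"
    using norm_add_sq_le[of "1/3" p "p' - p"] pp by (simp add: P_def P'_def)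
  also have "\<dots> \<le> 4 / 3 * P + 4 * (1 / 1296 * r)"
    using y nonneg power_mono[of y "1/36" 2] by (intro add_left_mono mult_left_mono mult_right_mono) (auto simp: power_divide)
  finally have "q * \<gamma>' * P' \<le> q * \<gamma>' * (4 / 3 * P + 4 * (1 / 1296 * r))"
    using q y' y assms(12,15) by (intro mult_left_mono) auto
  also have "\<dots> \<le> q * \<gamma> * (4 / 3 * P + 4 * (1 / 1296 * r))"
    using q nonneg assms(14) by (intro mult_right_mono mult_left_mono) auto
  also have "\<dots> = q * (\<gamma> * P) + q * (\<gamma> * P) / 3 + q * (\<gamma> * r) / 324"
    by (simp add: algebra_simps)
  also have "\<dots> \<le> q * (\<gamma> * P) + (3 / 8) * (\<gamma> * P) / 3 + (3 / 8) * (\<gamma> * r) / 324"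
    using q nonneg \<open>\<gamma> > 0\<close> by (intro add_mono divide_right_mono mult_right_mono) auto
  finally have grad': "q * \<gamma>' * P' \<le> q * (\<gamma> * P) + (\<gamma> * P) / 8 + (\<gamma> * r) / 864" by linarith
  have "7 * \<kappa> / (12 * L) * (\<beta> * S) \<le> 7 * \<kappa> / (12 * L) * ((1 - 24 * y) * S)"
    using \<beta> nonneg \<open>\<kappa> > 0\<close> \<open>L > 0\<close> by (intro mult_left_mono mult_right_mono) auto
  also have "\<dots> = 7 * \<kappa> / (12 * L) * S - 14 * (\<gamma> * (\<kappa> * S))"
    using \<open>L > 0\<close> by (simp add: y_def field_simps)
  finally have spread: "7 * \<kappa> / (12 * L) * (\<beta> * S) \<le> 7 * \<kappa> / (12 * L) * S - 14 * (\<gamma> * (\<kappa> * S))" .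
  have dissim: "7 * \<kappa> / (12 * L) * ((1 - \<beta>) * (G\<^sup>2 + B\<^sup>2 * P')) = 21 * \<kappa> * G\<^sup>2 * \<gamma>' + q * \<gamma>' * P'"
    using \<open>L > 0\<close> by (simp add: \<beta>(3) q_def field_simps)
  \<comment> \<open>Each part of the Lyapunov function loses at least the fraction \<open>2 * \<alpha> * \<gamma>\<close>; for the two error
    terms this uses \<open>2 * \<alpha> \<le> 3 / 4 * L\<close>, that is, \<open>\<mu> \<le> L\<close>.\<close>
  have cF: "2 * \<alpha> * \<gamma> * F \<le> (3 / 8 - q) * (\<gamma> * P)"
  proof -
    have "2 * \<alpha> * \<gamma> * F = (3 / 8 - q) * \<gamma> * (2 * \<mu> * F)" by (simp add: \<alpha>4(3))
    also have "\<dots> \<le> (3 / 8 - q) * \<gamma> * P"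
      using PL[of x] q \<open>\<gamma> > 0\<close> by (intro mult_left_mono) (auto simp: F_def P_def p_def)
    finally show ?thesis by simp
  qed
  have cd: "2 * \<alpha> * \<gamma> * (d / (8 * L)) \<le> 3 / 32 * (\<gamma> * d)"
  proof -
    have "2 * \<alpha> * \<gamma> * (d / (8 * L)) \<le> (3 / 4 * L) * \<gamma> * (d / (8 * L))"
      using \<alpha>4 nonneg \<open>L > 0\<close> \<open>\<gamma> > 0\<close> by (intro mult_right_mono) auto
    also have "\<dots> = 3 / 32 * (\<gamma> * d)" using \<open>L > 0\<close> by simp
    finally show ?thesis .
  qed
  have cS: "2 * \<alpha> * \<gamma> * (7 * \<kappa> / (12 * L) * S) \<le> 7 / 16 * (\<gamma> * (\<kappa> * S))"
  proof -
    have "2 * \<alpha> * \<gamma> * (7 * \<kappa> / (12 * L) * S) \<le> (3 / 4 * L) * \<gamma> * (7 * \<kappa> / (12 * L) * S)"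
      using \<alpha>4 nonneg \<open>L > 0\<close> \<open>\<gamma> > 0\<close> \<open>\<kappa> > 0\<close> by (intro mult_right_mono) auto
    also have "\<dots> = 7 / 16 * (\<gamma> * (\<kappa> * S))" using \<open>L > 0\<close> by simp
    finally show ?thesis .
  qed
  have "F' + \<beta>\<^sup>2 * d' / (8 * L) + 7 * \<kappa> / (12 * L) * (\<beta> * S + (1 - \<beta>) * (G\<^sup>2 + B\<^sup>2 * P'))
     = F' + \<beta>\<^sup>2 * d' / (8 * L) + 7 * \<kappa> / (12 * L) * (\<beta> * S)
       + 7 * \<kappa> / (12 * L) * ((1 - \<beta>) * (G\<^sup>2 + B\<^sup>2 * P'))"
    by (simp add: distrib_left)
  also have "\<dots> \<le> F + d / (8 * L) + 7 * \<kappa> / (12 * L) * S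
      - 2 * \<alpha> * \<gamma> * F - 2 * \<alpha> * \<gamma> * (d / (8 * L)) - 2 * \<alpha> * \<gamma> * (7 * \<kappa> / (12 * L) * S)
      + 21 * \<kappa> * G\<^sup>2 * \<gamma>'"
  proof -
    have "0 \<le> \<gamma> * r" "0 \<le> \<gamma> * d" "0 \<le> \<gamma> * (\<kappa> * S)"
      using nonneg \<open>\<gamma> > 0\<close> \<open>\<kappa> > 0\<close> by auto
    moreover have "(3 / 8 - q) * (\<gamma> * P) = 3 / 8 * (\<gamma> * P) - q * (\<gamma> * P)" by (simp add: left_diff_distrib)
    ultimately show ?thesis
      using descent momentum spread grad' cF cd cS unfolding dissim by linarith
  qed
  also have "\<dots> = (1 - 2 * \<alpha> * \<gamma>) * (F + d / (8 * L) + 7 * \<kappa> / (12 * L) * S) + 21 * \<kappa> * G\<^sup>2 * \<gamma>'"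
    by (simp only: left_diff_distrib distrib_left mult_1_left)
  finally show ?thesis
    unfolding drift_def lyapunov_def x'_def[symmetric] p'_def[symmetric] p_def[symmetric]
      a_def[symmetric] d_def[symmetric] d'_def[symmetric] P'_def[symmetric] S_def[symmetric]
      F_def[symmetric] F'_def[symmetric] \<beta>_def[symmetric] .
qed

text \<open>
  Zero initial momenta leave the full gradient as initial error, which smoothness bounds by the
  initial gap. The factor \<open>\<beta>\<^sup>2\<close> in front of it makes room for the dissimilarity term.
\<close>

lemma drift_initial:
  fixes H :: "'n::finite set"
  assumes smooth: "smooth L \<phi>" and "L > 0" and lower: "\<And>y. c \<le> \<phi> y"
    and "\<kappa> > 0" and kB: "\<kappa> * B\<^sup>2 < 1 / 56" and "\<gamma> > 0" "36 * L * \<gamma> \<le> 1"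
    and m: "\<And>i. i \<in> H \<Longrightarrow> m $ i = 0"
  shows "drift H \<phi> c L \<kappa> G B (1 - 36 * \<gamma> * L) x m \<le> 5 / 4 * (\<phi> x - c) + 21 * \<kappa> * G\<^sup>2 * \<gamma>"
proof -
  define P where "P = (norm (gradient \<phi> x))\<^sup>2"
  define F where "F = \<phi> x - c"
  define y where "y = L * \<gamma>"
  have y: "0 < y" "y \<le> 1 / 36" using \<open>L > 0\<close> \<open>\<gamma> > 0\<close> \<open>36 * L * \<gamma> \<le> 1\<close> by (auto simp: y_def)
  have P: "0 \<le> P" "P \<le> 2 * L * F"
    unfolding P_def F_def using smooth_gradient_bound[OF smooth \<open>L > 0\<close> lower] by auto
  have F: "0 \<le> F" using lower by (simp add: F_def)
  have avg: "avg H m = 0" using m by (simp add: avg_def)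
  have "spread H m = 0" using m by (simp add: spread_def avg)
  then have "drift H \<phi> c L \<kappa> G B (1 - 36 * \<gamma> * L) x m =
      F + (1 - 36 * y)\<^sup>2 * P / (8 * L) + 21 * \<kappa> * G\<^sup>2 * \<gamma> + 21 * (\<kappa> * B\<^sup>2) * (\<gamma> * P)"
    using \<open>L > 0\<close> by (simp add: drift_def avg P_def F_def y_def field_simps)
  also have "(1 - 36 * y)\<^sup>2 * P / (8 * L) \<le> (1 - 36 * y) * (2 * L * F) / (8 * L)"
    using y P F \<open>L > 0\<close> mult_right_mono[of "1 - 36 * y" 1 "1 - 36 * y"]
    by (intro divide_right_mono mult_mono) (auto simp: power2_eq_square)
  also have "\<dots> = F / 4 - 9 * (y * F)" using \<open>L > 0\<close> by (simp add: field_simps)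
  also have "21 * (\<kappa> * B\<^sup>2) * (\<gamma> * P) \<le> 21 * (1 / 56) * (\<gamma> * (2 * L * F))"
    using P F \<open>\<gamma> > 0\<close> \<open>\<kappa> > 0\<close> \<open>L > 0\<close> kB by (intro mult_mono mult_left_mono) auto
  also have "\<dots> = 3 / 4 * (y * F)" by (simp add: y_def)
  finally have "drift H \<phi> c L \<kappa> G B (1 - 36 * \<gamma> * L) x m
      \<le> F + (F / 4 - 9 * (y * F)) + 21 * \<kappa> * G\<^sup>2 * \<gamma> + 3 / 4 * (y * F)" by simp
  moreover have "0 \<le> y * F" using y F by simp
  ultimately show ?thesis unfolding F_def[symmetric] by linarith
qed

section \<open>The step-size recursion\<close>

text \<open>
  By convexity, each square is at most the integral of \<open>y\<^sup>2\<close> over the unit interval centred at its base.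
\<close>

lemma sum_consecutive_squares_le:
  fixes s :: real
  assumes "s \<ge> 1 / 2"
  shows "(\<Sum>j<k. (s + real j)\<^sup>2) \<le> (s + real k - 1 / 2) ^ 3 / 3"
proof (induction k)
  case 0
  then show ?case using assms by simp
next
  case (Suc k)
  have "(s + real k)\<^sup>2 \<le> ((s + real k) + 1 / 2) ^ 3 / 3 - ((s + real k) - 1 / 2) ^ 3 / 3"
    by (simp add: power3_eq_cube power2_eq_square field_simps)
  with Suc show ?case by (simp add: algebra_simps)
qed

text \<open>
  Subtracting \<open>\<alpha>6 / (2 * \<alpha>)\<close>, the fixed point of the bias, leaves a recursion with noise
  \<open>\<alpha>5 * \<gamma>\<^sup>2\<close> only. In the first phase it is geometric with ratio \<open>1 - 4 / s0\<close>. In the second phase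
  the factors are \<open>1 - 4 / s\<close> with \<open>s\<close> growing by one, and \<open>s ^ 4 * (1 - 4 / s) \<le> (s - 1) ^ 4\<close>
  makes \<open>s ^ 4\<close> the telescoping weight: the value at the start of the phase is damped by
  \<open>(s0 - 1) ^ 4 / S ^ 4\<close> and the noise sums to a multiple of the sum of the squares \<open>s\<^sup>2\<close>, of order
  \<open>S ^ 3\<close>. With the single rate \<open>\<alpha>\<close> (weights \<open>s\<^sup>2\<close>) the constants would be lost.
\<close>

lemma two_phase_recursion_bound:
  fixes a \<gamma> :: "nat \<Rightarrow> real" and T :: nat
  assumes "T \<ge> 2" "\<alpha> > 0" "s0 \<ge> 4" "\<alpha>5 \<ge> 0" "\<alpha>6 \<ge> 0" "F \<ge> 0"
    and \<gamma>0: "\<gamma>0 = 2 / (\<alpha> * s0)"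
    and \<gamma>: "\<And>t. t \<ge> 1 \<Longrightarrow>
           \<gamma> t = (if t < T div 2 then \<gamma>0 else 2 / (\<alpha> * (s0 + real t - real (T div 2))))"
    and init: "a 1 \<le> 5 / 4 * F + \<alpha>6 * \<gamma>0 + \<alpha>5 * \<gamma>0\<^sup>2"
    and step: "\<And>t. t \<ge> 1 \<Longrightarrow> a (Suc t) \<le> (1 - 2 * \<alpha> * \<gamma> t) * a t + \<alpha>6 * \<gamma> t + \<alpha>5 * (\<gamma> t)\<^sup>2"
  shows "a T \<le> (s0 - 1)\<^sup>2 * F * (2 * exp (- \<alpha> * \<gamma>0 * (real (T div 2) - 1)) / (real T)\<^sup>2)
             + 2 * (\<alpha>5 * \<gamma>0 + \<alpha>6) * (s0 - 1)\<^sup>2 / (\<alpha> * (real T)\<^sup>2)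
             + 4 * \<alpha>5 / (\<alpha>\<^sup>2 * real T)
             + \<alpha>6 / \<alpha>"
proof -
  define W where "W t = a t - \<alpha>6 / (2 * \<alpha>)" for t
  define r where "r = 1 - 2 * \<alpha> * \<gamma>0"
  have \<gamma>0': "\<gamma>0 > 0" "\<alpha> * \<gamma>0 = 2 / s0" using assms(1-3) by (auto simp: \<gamma>0)
  have r: "0 \<le> r" "r \<le> 1" using assms(2,3) by (auto simp: r_def \<gamma>0)
  have W_step: "W (Suc t) \<le> (1 - 2 * \<alpha> * \<gamma> t) * W t + \<alpha>5 * (\<gamma> t)\<^sup>2" if "t \<ge> 1" for t
  proof -
    have "(1 - 2 * \<alpha> * \<gamma> t) * W t + \<alpha>5 * (\<gamma> t)\<^sup>2
        = (1 - 2 * \<alpha> * \<gamma> t) * a t + \<alpha>6 * \<gamma> t + \<alpha>5 * (\<gamma> t)\<^sup>2 - \<alpha>6 / (2 * \<alpha>)"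
      using \<open>\<alpha> > 0\<close> by (simp add: W_def field_simps)
    with step[OF that] show ?thesis by (simp add: W_def)
  qed
  define T0 where "T0 = T div 2"
  have "T0 \<ge> 1" "T0 \<le> T" using \<open>T \<ge> 2\<close> by (auto simp: T0_def)
  have phase1: "W (Suc k) \<le> r ^ k * (5 / 4 * F) + \<alpha>5 * \<gamma>0 / (2 * \<alpha>)" if "Suc k \<le> T0" for k
    using that
  proof (induction k)
    case 0
    have "\<alpha>6 * \<gamma>0 \<le> \<alpha>6 / (2 * \<alpha>)"
      using r \<open>\<alpha> > 0\<close> \<open>\<alpha>6 \<ge> 0\<close> mult_left_mono[of "2 * \<alpha> * \<gamma>0" 1 \<alpha>6] by (simp add: r_def field_simps)
    moreover have "\<alpha>5 * \<gamma>0\<^sup>2 \<le> \<alpha>5 * \<gamma>0 / (2 * \<alpha>)"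
      using r \<open>\<alpha> > 0\<close> \<open>\<alpha>5 \<ge> 0\<close> \<gamma>0' mult_left_mono[of "2 * \<alpha> * \<gamma>0" 1 "\<alpha>5 * \<gamma>0"]
      by (simp add: r_def field_simps power2_eq_square)
    ultimately show ?case using init by (simp add: W_def)
  next
    case (Suc k)
    have "\<gamma> (Suc k) = \<gamma>0" using \<gamma>[of "Suc k"] Suc.prems by (simp add: T0_def)
    then have "W (Suc (Suc k)) \<le> r * W (Suc k) + \<alpha>5 * \<gamma>0\<^sup>2"
      using W_step[of "Suc k"] by (simp add: r_def)
    also have "\<dots> \<le> r * (r ^ k * (5 / 4 * F) + \<alpha>5 * \<gamma>0 / (2 * \<alpha>)) + \<alpha>5 * \<gamma>0\<^sup>2"
      using Suc r by (intro add_right_mono mult_left_mono) auto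
    also have "\<dots> = r ^ Suc k * (5 / 4 * F) + \<alpha>5 * \<gamma>0 / (2 * \<alpha>)"
      using \<open>\<alpha> > 0\<close> by (simp add: r_def field_simps power2_eq_square)
    finally show ?case .
  qed
  define E where "E = r ^ (T0 - 1) * (5 / 4 * F)"
  define C where "C = E + \<alpha>5 * \<gamma>0 / (2 * \<alpha>)"
  have E: "0 \<le> E" using r \<open>F \<ge> 0\<close> by (simp add: E_def)
  have C: "W T0 \<le> C" "0 \<le> C"
    using phase1[of "T0 - 1"] \<open>T0 \<ge> 1\<close> E \<open>\<alpha> > 0\<close> \<open>\<alpha>5 \<ge> 0\<close> \<gamma>0' by (auto simp: E_def C_def)
  have phase2: "W (T0 + k) * (s0 + real k - 1) ^ 4
      \<le> (s0 - 1) ^ 4 * C + 4 * \<alpha>5 / \<alpha>\<^sup>2 * (\<Sum>j<k. (s0 + real j)\<^sup>2)" for k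
  proof (induction k)
    case 0
    then show ?case using C assms(3) by (simp add: mult.commute mult_left_mono)
  next
    case (Suc k)
    define s where "s = s0 + real k"
    define Z where "Z = (s0 - 1) ^ 4 * C + 4 * \<alpha>5 / \<alpha>\<^sup>2 * (\<Sum>j<k. (s0 + real j)\<^sup>2)"
    have s: "s \<ge> 4" using assms(3) by (simp add: s_def)
    have Z: "0 \<le> Z" unfolding Z_def using C assms(4)
      by (intro add_nonneg_nonneg mult_nonneg_nonneg sum_nonneg divide_nonneg_nonneg) auto
    have \<gamma>s: "\<gamma> (T0 + k) = 2 / (\<alpha> * s)"
      using \<gamma>[of "T0 + k"] \<open>T0 \<ge> 1\<close> by (simp add: T0_def s_def)
    have bernoulli: "(1 - 4 / s) * s ^ 4 \<le> (s - 1) ^ 4"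
    proof -
      have "1 + real 4 * (- 1 / s) \<le> (1 + (- 1 / s)) ^ 4"
        using s by (intro Bernoulli_inequality) auto
      then have "(1 - 4 / s) * s ^ 4 \<le> (1 - 1 / s) ^ 4 * s ^ 4"
        using s by (intro mult_right_mono) auto
      also have "\<dots> = ((1 - 1 / s) * s) ^ 4" by (simp add: power_mult_distrib)
      also have "(1 - 1 / s) * s = s - 1" using s by (simp add: field_simps)
      finally show ?thesis .
    qed
    have "W (T0 + k) \<le> Z / (s - 1) ^ 4"
      using Suc s by (simp add: Z_def s_def field_simps)
    have "W (T0 + Suc k) \<le> (1 - 4 / s) * W (T0 + k) + \<alpha>5 * (2 / (\<alpha> * s))\<^sup>2"
      using W_step[of "T0 + k"] \<open>T0 \<ge> 1\<close> \<open>\<alpha> > 0\<close> by (simp add: \<gamma>s)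
    also have "\<dots> \<le> (1 - 4 / s) * (Z / (s - 1) ^ 4) + \<alpha>5 * (2 / (\<alpha> * s))\<^sup>2"
      using s \<open>W (T0 + k) \<le> Z / (s - 1) ^ 4\<close> by (intro add_right_mono mult_left_mono) auto
    finally have "W (T0 + Suc k) * s ^ 4 \<le> ((1 - 4 / s) * (Z / (s - 1) ^ 4) + \<alpha>5 * (2 / (\<alpha> * s))\<^sup>2) * s ^ 4"
      using s by (intro mult_right_mono) auto
    also have "\<dots> = ((1 - 4 / s) * s ^ 4) * (Z / (s - 1) ^ 4) + 4 * \<alpha>5 / \<alpha>\<^sup>2 * s\<^sup>2"
      using s \<open>\<alpha> > 0\<close> by (simp add: field_simps power2_eq_square power4_eq_xxxx)
    also have "\<dots> \<le> (s - 1) ^ 4 * (Z / (s - 1) ^ 4) + 4 * \<alpha>5 / \<alpha>\<^sup>2 * s\<^sup>2"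
      using bernoulli Z s by (intro add_right_mono mult_right_mono) auto
    also have "(s - 1) ^ 4 * (Z / (s - 1) ^ 4) = Z" using s by simp
    finally show ?case by (simp add: Z_def s_def algebra_simps)
  qed
  define N where "N = T - T0"
  define S where "S = s0 + real N - 1"
  have N: "T \<le> 2 * N" "N \<ge> 1" "T0 + N = T" using \<open>T \<ge> 2\<close> by (auto simp: N_def T0_def)
  have S: "S \<ge> 4" "S \<ge> s0" "S \<ge> real T / 2" using assms(3) N by (auto simp: S_def)
  have T: "real T > 0" using \<open>T \<ge> 2\<close> by simp
  have WT: "W T \<le> (s0 - 1) ^ 4 * C / S ^ 4 + 4 * \<alpha>5 / \<alpha>\<^sup>2 * (\<Sum>j<N. (s0 + real j)\<^sup>2) / S ^ 4"
  proof -
    have "W T * S ^ 4 \<le> (s0 - 1) ^ 4 * C + 4 * \<alpha>5 / \<alpha>\<^sup>2 * (\<Sum>j<N. (s0 + real j)\<^sup>2)"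
      using phase2[of N] by (simp add: N S_def)
    then have "W T \<le> ((s0 - 1) ^ 4 * C + 4 * \<alpha>5 / \<alpha>\<^sup>2 * (\<Sum>j<N. (s0 + real j)\<^sup>2)) / S ^ 4"
      using S by (simp add: pos_le_divide_eq)
    then show ?thesis by (simp only: add_divide_distrib)
  qed
  have "(\<Sum>j<N. (s0 + real j)\<^sup>2) * real T \<le> S ^ 4"
  proof -
    have "(\<Sum>j<N. (s0 + real j)\<^sup>2) * real T \<le> ((S + 1 / 2) ^ 3 / 3) * (2 * (S - 1))"
      using sum_consecutive_squares_le[of s0 N] N S assms(3)
      by (intro mult_mono) (auto simp: S_def sum_nonneg algebra_simps)
    also have "\<dots> = 2 / 3 * (S ^ 4 + 1 / 2 * S ^ 3 - 3 / 4 * S\<^sup>2 - 5 / 8 * S - 1 / 8)"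
      by (simp add: field_simps power2_eq_square power3_eq_cube power4_eq_xxxx)
    also have "\<dots> \<le> 2 / 3 * (S ^ 4 + 1 / 2 * S ^ 4)"
    proof -
      have "S ^ 3 \<le> S ^ 4" using S by (intro power_increasing) auto
      moreover have "0 \<le> S\<^sup>2" by simp
      ultimately have "S ^ 4 + 1 / 2 * S ^ 3 - 3 / 4 * S\<^sup>2 - 5 / 8 * S - 1 / 8 \<le> S ^ 4 + 1 / 2 * S ^ 4"
        using S by linarith
      then show ?thesis by simp
    qed
    finally show ?thesis by simp
  qed
  then have "(\<Sum>j<N. (s0 + real j)\<^sup>2) / S ^ 4 \<le> 1 / real T"
    using S T by (simp add: field_simps)
  then have "4 * \<alpha>5 / \<alpha>\<^sup>2 * ((\<Sum>j<N. (s0 + real j)\<^sup>2) / S ^ 4) \<le> 4 * \<alpha>5 / \<alpha>\<^sup>2 * (1 / real T)"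
    using assms(2,4) by (intro mult_left_mono) auto
  then have noise: "4 * \<alpha>5 / \<alpha>\<^sup>2 * (\<Sum>j<N. (s0 + real j)\<^sup>2) / S ^ 4 \<le> 4 * \<alpha>5 / (\<alpha>\<^sup>2 * real T)"
    by simp
  have T2: "(real T)\<^sup>2 \<le> 4 * S\<^sup>2"
    using power_mono[of "real T / 2" S 2] S by (simp add: power_divide)
  have "(s0 - 1) ^ 4 / S ^ 4 = ((s0 - 1)\<^sup>2 / S\<^sup>2) * ((s0 - 1)\<^sup>2 / S\<^sup>2)"
    by (simp add: power2_eq_square power4_eq_xxxx)
  also have "\<dots> \<le> 1 * ((s0 - 1)\<^sup>2 * 4 / (real T)\<^sup>2)"
  proof (intro mult_mono)
    show "(s0 - 1)\<^sup>2 / S\<^sup>2 \<le> 1" using S assms(3) by (simp add: power_mono)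
    have "(s0 - 1)\<^sup>2 * (real T)\<^sup>2 \<le> (s0 - 1)\<^sup>2 * (4 * S\<^sup>2)" using T2 by (intro mult_left_mono) auto
    then show "(s0 - 1)\<^sup>2 / S\<^sup>2 \<le> (s0 - 1)\<^sup>2 * 4 / (real T)\<^sup>2"
      using S T by (simp add: field_simps)
  qed auto
  finally have "(s0 - 1) ^ 4 / S ^ 4 * (\<alpha>5 * \<gamma>0 / (2 * \<alpha>))
      \<le> 1 * ((s0 - 1)\<^sup>2 * 4 / (real T)\<^sup>2) * (\<alpha>5 * \<gamma>0 / (2 * \<alpha>))"
    using assms(2,4) \<gamma>0' by (intro mult_right_mono) auto
  also have "\<dots> \<le> 2 * (\<alpha>5 * \<gamma>0 + \<alpha>6) * (s0 - 1)\<^sup>2 / (\<alpha> * (real T)\<^sup>2)"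
    using assms(2,5) T by (simp add: field_simps)
  finally have noise1: "(s0 - 1) ^ 4 / S ^ 4 * (\<alpha>5 * \<gamma>0 / (2 * \<alpha>))
      \<le> 2 * (\<alpha>5 * \<gamma>0 + \<alpha>6) * (s0 - 1)\<^sup>2 / (\<alpha> * (real T)\<^sup>2)" .
  define e where "e = exp (- \<alpha> * \<gamma>0 * (real (T div 2) - 1))"
  have re: "r ^ (T0 - 1) \<le> e"
  proof -
    have "r \<le> exp (- (2 * \<alpha> * \<gamma>0))" using exp_ge_add_one_self[of "- (2 * \<alpha> * \<gamma>0)"] by (simp add: r_def)
    also have "\<dots> \<le> exp (- (\<alpha> * \<gamma>0))"
      using mult_pos_pos[OF \<open>\<alpha> > 0\<close> \<gamma>0'(1)] by simp
    finally have "r ^ (T0 - 1) \<le> exp (- (\<alpha> * \<gamma>0)) ^ (T0 - 1)" using r by (intro power_mono)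
    also have "\<dots> = e"
      using \<open>T0 \<ge> 1\<close> by (simp add: e_def T0_def exp_of_nat_mult[symmetric] of_nat_diff mult_ac)
    finally show ?thesis .
  qed
  \<comment> \<open>The factor \<open>5 / 4\<close> in front of the initial gap is absorbed by a fourth power of \<open>S\<close>, since
    \<open>S = (s0 - 1) + N\<close> is at least twice the geometric mean of its summands.\<close>
  have "2 * (s0 - 1) * real T \<le> S\<^sup>2"
  proof -
    have "2 * (s0 - 1) * real T \<le> 4 * (s0 - 1) * real N" 
      using mult_left_mono[of "real T" "2 * real N" "2 * (s0 - 1)"] N(1) assms(3) by (simp add: mult_ac)
    also have "\<dots> \<le> ((s0 - 1) - real N)\<^sup>2 + 4 * (s0 - 1) * real N" by simp
    also have "\<dots> = S\<^sup>2" by (simp add: S_def power2_eq_square algebra_simps)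
    finally show ?thesis .
  qed
  then have "(2 * (s0 - 1) * real T)\<^sup>2 \<le> (S\<^sup>2)\<^sup>2" using assms(3) by (intro power_mono) auto
  then have S4: "4 * ((s0 - 1)\<^sup>2 * (real T)\<^sup>2) \<le> S ^ 4"
    unfolding power_mult_distrib by (simp del: power_mult_distrib right_diff_distrib left_diff_distrib)
  have "(s0 - 1) ^ 4 / S ^ 4 \<le> (s0 - 1)\<^sup>2 / (4 * (real T)\<^sup>2)"
  proof -
    have "(s0 - 1)\<^sup>2 * (4 * ((s0 - 1)\<^sup>2 * (real T)\<^sup>2)) \<le> (s0 - 1)\<^sup>2 * S ^ 4"
      using S4 by (intro mult_left_mono) auto
    then show ?thesis using S T by (simp add: field_simps power4_eq_xxxx power2_eq_square)
  qed
  then have "(s0 - 1) ^ 4 / S ^ 4 * E \<le> (s0 - 1)\<^sup>2 / (4 * (real T)\<^sup>2) * (e * (5 / 4 * F))"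
    using re r E \<open>F \<ge> 0\<close> order_trans[OF _ re, of 0] unfolding E_def by (intro mult_mono) auto
  also have "\<dots> \<le> (s0 - 1)\<^sup>2 * F * (2 * e / (real T)\<^sup>2)"
    using T \<open>F \<ge> 0\<close> by (simp add: e_def field_simps)
  finally have main: "(s0 - 1) ^ 4 / S ^ 4 * E \<le> (s0 - 1)\<^sup>2 * F * (2 * e / (real T)\<^sup>2)" .
  have "(s0 - 1) ^ 4 * C / S ^ 4 = (s0 - 1) ^ 4 / S ^ 4 * E + (s0 - 1) ^ 4 / S ^ 4 * (\<alpha>5 * \<gamma>0 / (2 * \<alpha>))"
    by (simp add: C_def distrib_left add_divide_distrib)
  moreover have "\<alpha>6 / (2 * \<alpha>) \<le> \<alpha>6 / \<alpha>" using assms(2,5) by (simp add: field_simps)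
  moreover have "a T = W T + \<alpha>6 / (2 * \<alpha>)" by (simp add: W_def)
  ultimately show ?thesis
    using WT noise noise1 main unfolding e_def by linarith
qed

section \<open>Second moments of independent noise\<close>

context prob_space
begin

lemma indep_var_inner:
  fixes X Y :: "'a \<Rightarrow> 'b :: euclidean_space"
  assumes indep: "indep_var borel X borel Y" and "integrable M X" "integrable M Y"
  shows "integrable M (\<lambda>\<omega>. inner (X \<omega>) (Y \<omega>))"
    and "expectation (\<lambda>\<omega>. inner (X \<omega>) (Y \<omega>)) = inner (expectation X) (expectation Y)"
proof -
  have *: "indep_var borel (\<lambda>\<omega>. inner (X \<omega>) b) borel (\<lambda>\<omega>. inner (Y \<omega>) b)" for b
    using indep_var_compose[OF indep, of "\<lambda>v. inner v b" borel "\<lambda>v. inner v b" borel]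
    by (simp add: comp_def)
  have int: "integrable M (\<lambda>\<omega>. inner (X \<omega>) b * inner (Y \<omega>) b)" for b
    using assms by (intro indep_var_integrable[OF *]) auto
  have eq: "inner (X \<omega>) (Y \<omega>) = (\<Sum>b\<in>Basis. inner (X \<omega>) b * inner (Y \<omega>) b)" for \<omega>
    by (rule euclidean_inner)
  show "integrable M (\<lambda>\<omega>. inner (X \<omega>) (Y \<omega>))"
    unfolding eq using int by auto
  have "expectation (\<lambda>\<omega>. inner (X \<omega>) (Y \<omega>)) = (\<Sum>b\<in>Basis. expectation (\<lambda>\<omega>. inner (X \<omega>) b * inner (Y \<omega>) b))"
    unfolding eq using int by (intro Bochner_Integration.integral_sum) auto
  also have "\<dots> = (\<Sum>b\<in>Basis. inner (expectation X) b * inner (expectation Y) b)"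
    using assms by (intro sum.cong refl) (subst indep_var_lebesgue_integral[OF *], auto)
  also have "\<dots> = inner (expectation X) (expectation Y)" by (rule euclidean_inner[symmetric])
  finally show "expectation (\<lambda>\<omega>. inner (X \<omega>) (Y \<omega>)) = inner (expectation X) (expectation Y)" .
qed

lemma expectation_norm_sq_shift:
  fixes X :: "'a \<Rightarrow> 'b :: euclidean_space"
  assumes X: "integrable M X" "expectation X = 0" and X2: "integrable M (\<lambda>\<omega>. (norm (X \<omega>))\<^sup>2)"
  shows "integrable M (\<lambda>\<omega>. (norm (u + k *\<^sub>R X \<omega>))\<^sup>2)"
    and "expectation (\<lambda>\<omega>. (norm (u + k *\<^sub>R X \<omega>))\<^sup>2) = (norm u)\<^sup>2 + k\<^sup>2 * expectation (\<lambda>\<omega>. (norm (X \<omega>))\<^sup>2)"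
proof -
  have eq: "(norm (u + k *\<^sub>R X \<omega>))\<^sup>2 = (norm u)\<^sup>2 + 2 * k * inner u (X \<omega>) + k\<^sup>2 * (norm (X \<omega>))\<^sup>2" for \<omega>
    by (simp add: power2_norm_eq_inner inner_add_left inner_add_right inner_commute power2_eq_square[of k] algebra_simps)
  show "integrable M (\<lambda>\<omega>. (norm (u + k *\<^sub>R X \<omega>))\<^sup>2)"
    unfolding eq using X X2 by auto
  show "expectation (\<lambda>\<omega>. (norm (u + k *\<^sub>R X \<omega>))\<^sup>2) = (norm u)\<^sup>2 + k\<^sup>2 * expectation (\<lambda>\<omega>. (norm (X \<omega>))\<^sup>2)"
    unfolding eq using X X2 by (simp add: prob_space)
qed

lemma expectation_norm_sq_sum:
  fixes X :: "'i \<Rightarrow> 'a \<Rightarrow> 'b :: euclidean_space"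
  assumes "finite I"
    and X: "\<And>i. i \<in> I \<Longrightarrow> integrable M (X i)" "\<And>i. i \<in> I \<Longrightarrow> expectation (X i) = 0"
    and X2: "\<And>i. i \<in> I \<Longrightarrow> integrable M (\<lambda>\<omega>. (norm (X i \<omega>))\<^sup>2)"
    and indep: "indep_vars (\<lambda>_. borel) X I"
  shows "integrable M (\<lambda>\<omega>. (norm (\<Sum>i\<in>I. X i \<omega>))\<^sup>2)"
    and "expectation (\<lambda>\<omega>. (norm (\<Sum>i\<in>I. X i \<omega>))\<^sup>2) = (\<Sum>i\<in>I. expectation (\<lambda>\<omega>. (norm (X i \<omega>))\<^sup>2))"
proof -
  have eq: "(norm (\<Sum>i\<in>I. X i \<omega>))\<^sup>2 = (\<Sum>i\<in>I. \<Sum>j\<in>I. inner (X i \<omega>) (X j \<omega>))" for \<omega>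
    by (simp only: power2_norm_eq_inner inner_sum_left inner_sum_right) (rule sum.swap)
  have ij: "indep_var borel (X i) borel (X j)" if "i \<in> I" "j \<in> I" "i \<noteq> j" for i j
    using indep_var_compose[OF indep_var_restrict[OF indep, of "{i}" "{j}"],
        of "\<lambda>f. f i" borel "\<lambda>f. f j" borel] that by (simp add: comp_def)
  have int: "integrable M (\<lambda>\<omega>. inner (X i \<omega>) (X j \<omega>))" if "i \<in> I" "j \<in> I" for i j
  proof (cases "i = j")
    case True
    then show ?thesis using X2[OF that(1)] by (simp add: power2_norm_eq_inner)
  next
    case False
    then show ?thesis using indep_var_inner(1)[OF ij] X that by auto
  qed
  have E: "expectation (\<lambda>\<omega>. inner (X i \<omega>) (X j \<omega>)) = (if j = i then expectation (\<lambda>\<omega>. (norm (X i \<omega>))\<^sup>2) else 0)"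
    if "i \<in> I" "j \<in> I" for i j
    using indep_var_inner(2)[OF ij[of i j]] X that by (auto simp: power2_norm_eq_inner)
  show "integrable M (\<lambda>\<omega>. (norm (\<Sum>i\<in>I. X i \<omega>))\<^sup>2)"
    unfolding eq using int by auto
  have "expectation (\<lambda>\<omega>. (norm (\<Sum>i\<in>I. X i \<omega>))\<^sup>2) = (\<Sum>i\<in>I. \<Sum>j\<in>I. expectation (\<lambda>\<omega>. inner (X i \<omega>) (X j \<omega>)))"
    unfolding eq using int by (subst Bochner_Integration.integral_sum) auto
  also have "\<dots> = (\<Sum>i\<in>I. expectation (\<lambda>\<omega>. (norm (X i \<omega>))\<^sup>2))"
    using \<open>finite I\<close> by (simp add: E cong: sum.cong)
  finally show "expectation (\<lambda>\<omega>. (norm (\<Sum>i\<in>I. X i \<omega>))\<^sup>2) = (\<Sum>i\<in>I. expectation (\<lambda>\<omega>. (norm (X i \<omega>))\<^sup>2))" .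
qed

text \<open>
  Conditioning on \<open>\<A>\<close> without conditional expectations: for \<open>Y\<close> independent of \<open>\<A>\<close>, the value of \<open>X\<close>
  may be frozen while integrating over \<open>Y\<close>. Only nonnegative integrals occur, so no moment of \<open>X\<close>
  has to be known to be finite. The hypothesis is stated with \<open>indep_set\<close> because \<open>indep_var\<close> would
  force \<open>X\<close> and \<open>Y\<close> to have the same type of values.
\<close>

lemma nn_integral_indep_le:
  assumes indep: "indep_set (sets \<A>) (sets \<B>)" and sp: "space \<A> = space M" "space \<B> = space M"
    and X: "X \<in> measurable \<A> S" and Y: "Y \<in> measurable \<B> N"
    and \<Phi>[measurable]: "\<Phi> \<in> borel_measurable (S \<Otimes>\<^sub>M N)"
    and le: "\<And>\<omega>. \<omega> \<in> space M \<Longrightarrow> (\<integral>\<^sup>+\<omega>'. \<Phi> (X \<omega>, Y \<omega>') \<partial>M) \<le> \<Psi> \<omega>"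
  shows "(\<integral>\<^sup>+\<omega>. \<Phi> (X \<omega>, Y \<omega>) \<partial>M) \<le> (\<integral>\<^sup>+\<omega>. \<Psi> \<omega> \<partial>M)"
proof -
  have [measurable]: "X \<in> measurable M S"
    using indep_setD_ev1[OF indep] sp by (intro measurable_from_subalg[OF _ X]) (simp add: subalgebra_def)
  have [measurable]: "Y \<in> measurable M N"
    using indep_setD_ev2[OF indep] sp by (intro measurable_from_subalg[OF _ Y]) (simp add: subalgebra_def)
  interpret X: prob_space "distr M S X" by (rule prob_space_distr) simp
  interpret Y: prob_space "distr M N Y" by (rule prob_space_distr) simp
  have eq: "distr M S X \<Otimes>\<^sub>M distr M N Y = distr M (S \<Otimes>\<^sub>M N) (\<lambda>\<omega>. (X \<omega>, Y \<omega>))"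
  proof (rule pair_measure_eqI)
    fix E F assume "E \<in> sets (distr M S X)" "F \<in> sets (distr M N Y)"
    then have [measurable]: "E \<in> sets S" "F \<in> sets N" by auto
    have "prob ((X -` E \<inter> space M) \<inter> (Y -` F \<inter> space M)) = prob (X -` E \<inter> space M) * prob (Y -` F \<inter> space M)"
      using measurable_sets[OF X, of E] measurable_sets[OF Y, of F] sp by (intro indep_setD[OF indep]) auto
    moreover have "(\<lambda>\<omega>. (X \<omega>, Y \<omega>)) -` (E \<times> F) \<inter> space M = (X -` E \<inter> space M) \<inter> (Y -` F \<inter> space M)"
      by auto
    ultimately show "emeasure (distr M S X) E * emeasure (distr M N Y) F
        = emeasure (distr M (S \<Otimes>\<^sub>M N) (\<lambda>\<omega>. (X \<omega>, Y \<omega>))) (E \<times> F)"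
      by (simp add: emeasure_distr emeasure_eq_measure ennreal_mult')
  qed (auto intro: X.sigma_finite_measure_axioms Y.sigma_finite_measure_axioms cong: sets_pair_measure_cong)
  have "(\<integral>\<^sup>+\<omega>. \<Phi> (X \<omega>, Y \<omega>) \<partial>M) = (\<integral>\<^sup>+z. \<Phi> z \<partial>(distr M S X \<Otimes>\<^sub>M distr M N Y))"
    unfolding eq by (subst nn_integral_distr) auto
  also have "\<dots> = (\<integral>\<^sup>+a. \<integral>\<^sup>+b. \<Phi> (a, b) \<partial>distr M N Y \<partial>distr M S X)"
    by (rule Y.nn_integral_fst[symmetric]) simp
  also have "\<dots> = (\<integral>\<^sup>+\<omega>. \<integral>\<^sup>+b. \<Phi> (X \<omega>, b) \<partial>distr M N Y \<partial>M)"
    by (subst nn_integral_distr) auto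
  also have "\<dots> \<le> (\<integral>\<^sup>+\<omega>. \<Psi> \<omega> \<partial>M)"
  proof (rule nn_integral_mono)
    fix \<omega> assume \<omega>: "\<omega> \<in> space M"
    then have [simp]: "X \<omega> \<in> space S" using measurable_space[OF X] sp by simp
    have "(\<integral>\<^sup>+b. \<Phi> (X \<omega>, b) \<partial>distr M N Y) = (\<integral>\<^sup>+\<omega>'. \<Phi> (X \<omega>, Y \<omega>') \<partial>M)"
      by (subst nn_integral_distr) auto
    then show "(\<integral>\<^sup>+b. \<Phi> (X \<omega>, b) \<partial>distr M N Y) \<le> \<Psi> \<omega>" using le[OF \<omega>] by simp
  qed
  finally show ?thesis .
qed

end

lemma sum_norm_sq_centered_le:
  fixes v :: "'i \<Rightarrow> 'b :: real_inner"
  assumes "finite I"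
  shows "(\<Sum>i\<in>I. (norm (v i - (1 / real (card I)) *\<^sub>R (\<Sum>j\<in>I. v j)))\<^sup>2) \<le> (\<Sum>i\<in>I. (norm (v i))\<^sup>2)"
proof (cases "I = {}")
  case False
  define w where "w = (1 / real (card I)) *\<^sub>R (\<Sum>j\<in>I. v j)"
  have "card I > 0" using False assms by (simp add: card_gt_0_iff)
  then have w: "(\<Sum>j\<in>I. v j) = real (card I) *\<^sub>R w" by (simp add: w_def)
  have "(\<Sum>i\<in>I. (norm (v i - w))\<^sup>2) = (\<Sum>i\<in>I. (norm (v i))\<^sup>2 - 2 * inner (v i) w + (norm w)\<^sup>2)"
    by (intro sum.cong refl) (simp add: power2_norm_eq_inner inner_diff_left inner_diff_right inner_commute)
  also have "\<dots> = (\<Sum>i\<in>I. (norm (v i))\<^sup>2) - 2 * inner (\<Sum>i\<in>I. v i) w + real (card I) * (norm w)\<^sup>2"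
    by (simp add: sum.distrib sum_subtractf inner_sum_left sum_distrib_left)
  also have "\<dots> = (\<Sum>i\<in>I. (norm (v i))\<^sup>2) - real (card I) * (norm w)\<^sup>2"
    unfolding w by (simp add: power2_norm_eq_inner)
  finally show ?thesis by (simp add: w_def)
qed simp

lemma norm_sq_convex:
  fixes u v :: "'b :: real_inner"
  assumes "0 \<le> \<beta>" "\<beta> \<le> 1"
  shows "(norm (\<beta> *\<^sub>R u + (1 - \<beta>) *\<^sub>R v))\<^sup>2 \<le> \<beta> * (norm u)\<^sup>2 + (1 - \<beta>) * (norm v)\<^sup>2"
proof -
  have "\<beta> * (norm u)\<^sup>2 + (1 - \<beta>) * (norm v)\<^sup>2 - (norm (\<beta> *\<^sub>R u + (1 - \<beta>) *\<^sub>R v))\<^sup>2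
      = \<beta> * (1 - \<beta>) * (norm (u - v))\<^sup>2"
    by (simp add: power2_norm_eq_inner inner_add_left inner_add_right inner_diff_left inner_diff_right
        inner_commute algebra_simps)
  moreover have "0 \<le> \<beta> * (1 - \<beta>) * (norm (u - v))\<^sup>2" using assms by simp
  ultimately show ?thesis by linarith
qed

lemma avg_cong: "(\<And>i. i \<in> H \<Longrightarrow> m $ i = m' $ i) \<Longrightarrow> avg H m = avg H m'"
  by (simp add: avg_def)

lemma spread_cong: "(\<And>i. i \<in> H \<Longrightarrow> m $ i = m' $ i) \<Longrightarrow> spread H m = spread H m'"
  using avg_cong[of H m m'] by (simp add: spread_def)

lemma lyapunov_cong:
  "(\<And>i. i \<in> H \<Longrightarrow> m $ i = m' $ i) \<Longrightarrow> lyapunov H \<phi> c L \<kappa> x m = lyapunov H \<phi> c L \<kappa> x m'"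
  using avg_cong[of H m m'] spread_cong[of H m m'] by (simp add: lyapunov_def)

text \<open>
  One momentum update at a fixed state. The noise is centred, so every squared norm splits into its
  noise-free part and a variance: independence of the workers divides the variance of the average by
  \<open>card H\<close>, and centring at the average only decreases the variance in the spread. The
  noise-free part of the spread is a convex combination of the old spread and of the dissimilarity.
\<close>

lemma (in prob_space) expected_lyapunov_le:
  fixes H :: "'n::finite set" and X :: "'n \<Rightarrow> 'a \<Rightarrow> real ^ 'd"
  assumes "H \<noteq> {}" "L > 0" "\<kappa> \<ge> 0" "0 \<le> \<beta>" "\<beta> \<le> 1"
    and lower: "c \<le> \<phi> x"
    and X: "\<And>i. i \<in> H \<Longrightarrow> integrable M (X i)"
    and X2: "\<And>i. i \<in> H \<Longrightarrow> integrable M (\<lambda>\<omega>. (norm (X i \<omega> - expectation (X i)))\<^sup>2)"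
    and var: "\<And>i. i \<in> H \<Longrightarrow> expectation (\<lambda>\<omega>. (norm (X i \<omega> - expectation (X i)))\<^sup>2) \<le> v"
    and indep: "indep_vars (\<lambda>_. borel) X H"
    and mean: "(1 / real (card H)) *\<^sub>R (\<Sum>i\<in>H. expectation (X i)) = gradient \<phi> x"
    and dissim: "(1 / real (card H)) * (\<Sum>i\<in>H. (norm (expectation (X i) - gradient \<phi> x))\<^sup>2)
      \<le> G\<^sup>2 + B\<^sup>2 * (norm (gradient \<phi> x))\<^sup>2"
  shows "(\<integral>\<^sup>+\<omega>. ennreal (lyapunov H \<phi> c L \<kappa> x (\<chi> i. \<beta> *\<^sub>R (m $ i) + (1 - \<beta>) *\<^sub>R X i \<omega>)) \<partial>M)
    \<le> ennreal (drift H \<phi> c L \<kappa> G B \<beta> x m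
        + (1 - \<beta>)\<^sup>2 * (1 / (8 * L * real (card H)) + 7 * \<kappa> / (12 * L)) * v)"
proof -
  define h where "h = real (card H)"
  have h: "h > 0" using \<open>H \<noteq> {}\<close> by (simp add: h_def card_gt_0_iff)
  define k where "k = 1 - \<beta>"
  define p where "p = gradient \<phi> x"
  define e where "e i = expectation (X i)" for i
  define n where "n i \<omega> = X i \<omega> - e i" for i \<omega>
  define nb where "nb \<omega> = (1 / h) *\<^sub>R (\<Sum>i\<in>H. n i \<omega>)" for \<omega>
  define u where "u = \<beta> *\<^sub>R (avg H m - p)"
  define w where "w i = \<beta> *\<^sub>R (m $ i - avg H m) + (1 - \<beta>) *\<^sub>R (e i - p)" for i
  define Y where "Y \<omega> = (\<chi> i. \<beta> *\<^sub>R (m $ i) + (1 - \<beta>) *\<^sub>R X i \<omega>)" for \<omega>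
  have n: "integrable M (n i)" "expectation (n i) = 0" "integrable M (\<lambda>\<omega>. (norm (n i \<omega>))\<^sup>2)"
    "expectation (\<lambda>\<omega>. (norm (n i \<omega>))\<^sup>2) \<le> v" if "i \<in> H" for i
    using X[OF that] X2[OF that] var[OF that] by (auto simp: n_def[abs_def] e_def prob_space)
  have "indep_vars (\<lambda>_. borel) n H"
    using indep_vars_compose2[OF indep, of "\<lambda>i v. v - e i" "\<lambda>_. borel"] by (simp add: n_def[abs_def])
  note sum_n = expectation_norm_sq_sum[OF _ n(1-3) this, simplified]
  have nb: "integrable M nb" "expectation nb = 0" "integrable M (\<lambda>\<omega>. (norm (nb \<omega>))\<^sup>2)"
    using n sum_n(1) by (auto simp: nb_def[abs_def] power_divide)
  have nb_var: "expectation (\<lambda>\<omega>. (norm (nb \<omega>))\<^sup>2) \<le> v / h"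
  proof -
    have "expectation (\<lambda>\<omega>. (norm (nb \<omega>))\<^sup>2) = (1 / h)\<^sup>2 * (\<Sum>i\<in>H. expectation (\<lambda>\<omega>. (norm (n i \<omega>))\<^sup>2))"
      by (simp add: nb_def power_mult_distrib sum_n(2) power_divide)
    also have "\<dots> \<le> (1 / h)\<^sup>2 * (h * v)"
      using sum_mono[of H _ "\<lambda>_. v", OF n(4)] by (intro mult_left_mono) (auto simp: h_def)
    also have "\<dots> = v / h" using h by (simp add: power2_eq_square)
    finally show ?thesis .
  qed
  have avgY: "avg H (Y \<omega>) = \<beta> *\<^sub>R avg H m + k *\<^sub>R (p + nb \<omega>)" for \<omega>
  proof -
    have "(\<Sum>i\<in>H. X i \<omega>) = (\<Sum>i\<in>H. e i) + (\<Sum>i\<in>H. n i \<omega>)" by (simp add: n_def sum.distrib[symmetric])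
    then have "(1 / h) *\<^sub>R (\<Sum>i\<in>H. X i \<omega>) = p + nb \<omega>"
      using mean by (simp add: scaleR_add_right nb_def p_def e_def h_def)
    moreover have "avg H (Y \<omega>) = \<beta> *\<^sub>R avg H m + k *\<^sub>R ((1 / h) *\<^sub>R (\<Sum>i\<in>H. X i \<omega>))"
      by (simp add: avg_def Y_def sum.distrib scaleR_sum_right[symmetric] scaleR_add_right k_def h_def mult.commute)
    ultimately show ?thesis by simp
  qed
  have dev: "avg H (Y \<omega>) - p = u + k *\<^sub>R nb \<omega>" for \<omega>
    unfolding avgY u_def k_def by (simp add: algebra_simps)
  have devi: "Y \<omega> $ i - avg H (Y \<omega>) = w i + k *\<^sub>R (n i \<omega> - nb \<omega>)" for \<omega> i
    unfolding avgY w_def k_def by (simp add: Y_def n_def algebra_simps)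
  have lyap: "lyapunov H \<phi> c L \<kappa> x (Y \<omega>) = (\<phi> x - c) + (norm (u + k *\<^sub>R nb \<omega>))\<^sup>2 / (8 * L)
      + 7 * \<kappa> / (12 * L) * ((1 / h) * (\<Sum>i\<in>H. (norm (w i + k *\<^sub>R (n i \<omega> - nb \<omega>)))\<^sup>2))" for \<omega>
    unfolding lyapunov_def spread_def p_def[symmetric] dev devi h_def ..
  have ni: "integrable M (\<lambda>\<omega>. n i \<omega> - nb \<omega>)" "expectation (\<lambda>\<omega>. n i \<omega> - nb \<omega>) = 0"
    "integrable M (\<lambda>\<omega>. (norm (n i \<omega> - nb \<omega>))\<^sup>2)" if "i \<in> H" for i
  proof -
    show 1: "integrable M (\<lambda>\<omega>. n i \<omega> - nb \<omega>)" "expectation (\<lambda>\<omega>. n i \<omega> - nb \<omega>) = 0"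
      using n[OF that] nb by auto
    show "integrable M (\<lambda>\<omega>. (norm (n i \<omega> - nb \<omega>))\<^sup>2)"
    proof (rule Bochner_Integration.integrable_bound)
      show "integrable M (\<lambda>\<omega>. 2 * (norm (n i \<omega>))\<^sup>2 + 2 * (norm (nb \<omega>))\<^sup>2)"
        using n(3)[OF that] nb(3) by auto
      show "(\<lambda>\<omega>. (norm (n i \<omega> - nb \<omega>))\<^sup>2) \<in> borel_measurable M"
        using borel_measurable_integrable[OF 1(1)] by simp
      show "AE \<omega> in M. norm ((norm (n i \<omega> - nb \<omega>))\<^sup>2) \<le> norm (2 * (norm (n i \<omega>))\<^sup>2 + 2 * (norm (nb \<omega>))\<^sup>2)"
        using norm_add_sq_le[of 1 "n i _" "- nb _"] by (intro AE_I2) simp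
    qed
  qed
  note shift = expectation_norm_sq_shift[OF nb, of u k]
  note shifti = expectation_norm_sq_shift[OF ni]
  have int: "integrable M (\<lambda>\<omega>. lyapunov H \<phi> c L \<kappa> x (Y \<omega>))"
    unfolding lyap using shift(1) shifti(1) by auto
  have nonneg: "0 \<le> lyapunov H \<phi> c L \<kappa> x (Y \<omega>)" for \<omega>
    using lower \<open>L > 0\<close> \<open>\<kappa> \<ge> 0\<close> by (simp add: lyapunov_nonneg)
  have "(\<Sum>i\<in>H. expectation (\<lambda>\<omega>. (norm (n i \<omega> - nb \<omega>))\<^sup>2)) \<le> h * v"
  proof -
    have "(\<Sum>i\<in>H. expectation (\<lambda>\<omega>. (norm (n i \<omega> - nb \<omega>))\<^sup>2))
        = expectation (\<lambda>\<omega>. \<Sum>i\<in>H. (norm (n i \<omega> - nb \<omega>))\<^sup>2)"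
      using ni by (simp add: Bochner_Integration.integral_sum)
    also have "\<dots> \<le> expectation (\<lambda>\<omega>. \<Sum>i\<in>H. (norm (n i \<omega>))\<^sup>2)"
      using n(3) ni(3) sum_norm_sq_centered_le[of H "\<lambda>i. n i _"]
      by (intro integral_mono) (auto simp: nb_def h_def)
    also have "\<dots> = (\<Sum>i\<in>H. expectation (\<lambda>\<omega>. (norm (n i \<omega>))\<^sup>2))"
      using n(3) by (simp add: Bochner_Integration.integral_sum)
    also have "\<dots> \<le> h * v" using sum_mono[of H _ "\<lambda>_. v", OF n(4)] by (auto simp: h_def)
    finally show ?thesis .
  qed
  moreover have "(\<Sum>i\<in>H. (norm (w i))\<^sup>2) \<le> h * (\<beta> * spread H m + (1 - \<beta>) * (G\<^sup>2 + B\<^sup>2 * (norm p)\<^sup>2))"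
  proof -
    have "(\<Sum>i\<in>H. (norm (w i))\<^sup>2) \<le> (\<Sum>i\<in>H. \<beta> * (norm (m $ i - avg H m))\<^sup>2 + (1 - \<beta>) * (norm (e i - p))\<^sup>2)"
      unfolding w_def using assms(4,5) by (intro sum_mono norm_sq_convex)
    also have "\<dots> = \<beta> * (\<Sum>i\<in>H. (norm (m $ i - avg H m))\<^sup>2) + (1 - \<beta>) * (\<Sum>i\<in>H. (norm (e i - p))\<^sup>2)"
      by (simp only: sum.distrib sum_distrib_left)
    also have "\<dots> = h * (\<beta> * spread H m + (1 - \<beta>) * ((1 / h) * (\<Sum>i\<in>H. (norm (e i - p))\<^sup>2)))"
      using h by (simp add: spread_def h_def distrib_left)
    also have "\<dots> \<le> h * (\<beta> * spread H m + (1 - \<beta>) * (G\<^sup>2 + B\<^sup>2 * (norm p)\<^sup>2))"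
      using dissim h assms(5) by (intro mult_left_mono add_left_mono) (auto simp: e_def p_def h_def)
    finally show ?thesis .
  qed
  ultimately have "(\<Sum>i\<in>H. (norm (w i))\<^sup>2) + k\<^sup>2 * (\<Sum>i\<in>H. expectation (\<lambda>\<omega>. (norm (n i \<omega> - nb \<omega>))\<^sup>2))
      \<le> h * (\<beta> * spread H m + (1 - \<beta>) * (G\<^sup>2 + B\<^sup>2 * (norm p)\<^sup>2)) + k\<^sup>2 * (h * v)"
    by (intro add_mono mult_left_mono) auto
  then have dev_le: "(1 / h) * ((\<Sum>i\<in>H. (norm (w i))\<^sup>2) + k\<^sup>2 * (\<Sum>i\<in>H. expectation (\<lambda>\<omega>. (norm (n i \<omega> - nb \<omega>))\<^sup>2)))
      \<le> \<beta> * spread H m + (1 - \<beta>) * (G\<^sup>2 + B\<^sup>2 * (norm p)\<^sup>2) + k\<^sup>2 * v"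
    using h by (simp add: field_simps)
  have "expectation (\<lambda>\<omega>. lyapunov H \<phi> c L \<kappa> x (Y \<omega>)) =
      (\<phi> x - c) + expectation (\<lambda>\<omega>. (norm (u + k *\<^sub>R nb \<omega>))\<^sup>2) / (8 * L)
      + 7 * \<kappa> / (12 * L) * ((1 / h) * (\<Sum>i\<in>H. expectation (\<lambda>\<omega>. (norm (w i + k *\<^sub>R (n i \<omega> - nb \<omega>)))\<^sup>2)))"
    unfolding lyap using shift(1) shifti(1) by (simp add: prob_space Bochner_Integration.integral_sum)
  also have "\<dots> = (\<phi> x - c) + ((norm u)\<^sup>2 + k\<^sup>2 * expectation (\<lambda>\<omega>. (norm (nb \<omega>))\<^sup>2)) / (8 * L)
      + 7 * \<kappa> / (12 * L) * ((1 / h) * ((\<Sum>i\<in>H. (norm (w i))\<^sup>2)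
         + k\<^sup>2 * (\<Sum>i\<in>H. expectation (\<lambda>\<omega>. (norm (n i \<omega> - nb \<omega>))\<^sup>2))))"
    by (simp only: shift(2) shifti(2) sum.distrib sum_distrib_left cong: sum.cong)
  also have "\<dots> \<le> (\<phi> x - c) + ((norm u)\<^sup>2 + k\<^sup>2 * (v / h)) / (8 * L)
      + 7 * \<kappa> / (12 * L) * (\<beta> * spread H m + (1 - \<beta>) * (G\<^sup>2 + B\<^sup>2 * (norm p)\<^sup>2) + k\<^sup>2 * v)"
    using dev_le nb_var assms(2,3)
    by (intro add_mono mult_left_mono divide_right_mono order_refl) auto
  also have "\<dots> = drift H \<phi> c L \<kappa> G B \<beta> x m + (1 - \<beta>)\<^sup>2 * (1 / (8 * L * h) + 7 * \<kappa> / (12 * L)) * v"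
    unfolding drift_def u_def k_def p_def[symmetric] using h \<open>L > 0\<close>
    by (simp add: power_mult_distrib add_divide_distrib distrib_left distrib_right mult_ac)
  finally show ?thesis
    unfolding h_def[symmetric] Y_def[symmetric] nn_integral_eq_integral[OF int AE_I2[OF nonneg]]
    by (rule ennreal_leI)
qed

section \<open>Averaging over the fresh samples\<close>

text \<open>
  The first of the two sigma-algebras that \<open>fresh_samples\<close> declares independent.
\<close>

definition past :: "'w measure \<Rightarrow> 'n set \<Rightarrow> ('n \<Rightarrow> 's measure) \<Rightarrow> ('n \<Rightarrow> nat \<Rightarrow> 'w \<Rightarrow> 's) \<Rightarrow>
    (nat \<Rightarrow> 'w \<Rightarrow> real ^ 'd ^ 'n::finite) \<Rightarrow> nat \<Rightarrow> 'w measure" where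
  "past M H D \<xi> m t = vimage_algebra (space M) (\<lambda>\<omega>. \<lambda>r\<in>{1..<t}. (\<lambda>i\<in>H. \<xi> i r \<omega>, m r \<omega>))
     (\<Pi>\<^sub>M r\<in>{1..<t}. (\<Pi>\<^sub>M i\<in>H. D i) \<Otimes>\<^sub>M borel)"

lemma space_past [simp]: "space (past M H D \<xi> m t) = space M"
  by (simp add: past_def)

context prob_space
begin

context
  fixes H :: "'n::finite set" and D :: "'n \<Rightarrow> 's measure" and \<xi> :: "'n \<Rightarrow> nat \<Rightarrow> 'a \<Rightarrow> 's"
    and m :: "nat \<Rightarrow> 'a \<Rightarrow> real ^ 'd ^ 'n"
  assumes fresh: "fresh_samples M H D \<xi> m"
begin

lemma measurable_sample: "i \<in> H \<Longrightarrow> t \<ge> 1 \<Longrightarrow> \<xi> i t \<in> measurable M (D i)"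
  and distr_sample: "i \<in> H \<Longrightarrow> t \<ge> 1 \<Longrightarrow> distr M (D i) (\<xi> i t) = D i"
  using fresh by (auto simp: fresh_samples_def)

lemma subalgebra_past: "t \<ge> 1 \<Longrightarrow> subalgebra M (past M H D \<xi> m t)"
proof -
  assume "t \<ge> 1"
  then have "indep_set (sets (past M H D \<xi> m t)) (sets (vimage_algebra (space M) (\<lambda>\<omega>. \<lambda>i\<in>H. \<xi> i t \<omega>) (\<Pi>\<^sub>M i\<in>H. D i)))"
    using fresh by (simp add: fresh_samples_def past_def)
  then show ?thesis by (simp add: subalgebra_def indep_setD_ev1)
qed

lemma measurable_past_message:
  assumes "1 \<le> r" "r < t"
  shows "m r \<in> borel_measurable (past M H D \<xi> m t)"
proof -
  let ?N = "\<Pi>\<^sub>M r\<in>{1..<t}. (\<Pi>\<^sub>M i\<in>H. D i) \<Otimes>\<^sub>M (borel :: (real ^ 'd ^ 'n) measure)"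
  let ?hist = "\<lambda>\<omega>. \<lambda>r\<in>{1..<t}. (\<lambda>i\<in>H. \<xi> i r \<omega>, m r \<omega>)"
  have "?hist \<in> space M \<rightarrow> space ?N"
    using measurable_space[OF measurable_sample]
    by (auto simp: space_PiM space_pair_measure PiE_def Pi_def extensional_def restrict_def)
  then have "?hist \<in> measurable (past M H D \<xi> m t) ?N"
    unfolding past_def by (rule measurable_vimage_algebra1)
  moreover have "(\<lambda>f. snd (f r)) \<in> measurable ?N borel"
    using assms by (intro measurable_compose[where g = snd, OF measurable_component_singleton[of r] measurable_snd]) auto
  ultimately have "(\<lambda>\<omega>. snd (?hist \<omega> r)) \<in> borel_measurable (past M H D \<xi> m t)"
    by (rule measurable_compose)
  then show ?thesis using assms by simp
qed

lemma measurable_past_iterate: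
  assumes run: "RDSGDM M H A g \<gamma> \<beta> x0 \<xi> x m" and A: "A \<in> borel_measurable borel" and "r < t"
  shows "x r \<in> borel_measurable (past M H D \<xi> m t)"
  using \<open>r < t\<close>
proof (induction r)
  case 0
  have "x 0 \<omega> = x0" if "\<omega> \<in> space (past M H D \<xi> m t)" for \<omega>
    using run that by (simp add: RDSGDM_def)
  then show ?case by (subst measurable_cong[of _ _ "\<lambda>_. x0"]) auto
next
  case (Suc r)
  have "x (Suc r) \<omega> = x r \<omega> - \<gamma> (Suc r) *\<^sub>R A (m (Suc r) \<omega>)" if "\<omega> \<in> space (past M H D \<xi> m t)" for \<omega>
    using run that unfolding RDSGDM_def
    by (metis diff_Suc_1 le_add1 plus_1_eq_Suc space_past)
  moreover have "(\<lambda>\<omega>. x r \<omega> - \<gamma> (Suc r) *\<^sub>R A (m (Suc r) \<omega>)) \<in> borel_measurable (past M H D \<xi> m t)"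
    using Suc measurable_compose[OF measurable_past_message A, of "Suc r" t] by auto
  ultimately show ?case by (subst measurable_cong) auto
qed

lemma measurable_message: "1 \<le> t \<Longrightarrow> m t \<in> borel_measurable M"
  using measurable_from_subalg[OF subalgebra_past measurable_past_message, of "Suc t" t] by simp

lemma measurable_iterate:
  assumes "RDSGDM M H A g \<gamma> \<beta> x0 \<xi> x m" "A \<in> borel_measurable borel"
  shows "x t \<in> borel_measurable M"
  using measurable_from_subalg[OF subalgebra_past measurable_past_iterate[OF assms], of "Suc t" t] by simp

text \<open>
  The samples of round \<open>t\<close> act on the iterate and on the honest momenta, both of which belong to the
  past. Restricting the messages to \<open>H\<close> matters for \<open>t = 1\<close>, where the entries
  \<open>m 0 \<omega> $ j\<close> of Byzantine workers need not be measurable.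
\<close>

lemma measurable_past_state:
  assumes run: "RDSGDM M H A g \<gamma> \<beta> x0 \<xi> x m" and A: "A \<in> borel_measurable borel" and t: "t \<ge> 1"
  shows "(\<lambda>\<omega>. (x (t - 1) \<omega>, \<lambda>i\<in>H. m (t - 1) \<omega> $ i))
    \<in> measurable (past M H D \<xi> m t) (borel \<Otimes>\<^sub>M (\<Pi>\<^sub>M i\<in>H. borel))"
proof -
  have "(\<lambda>\<omega>. m (t - 1) \<omega> $ i) \<in> borel_measurable (past M H D \<xi> m t)" if "i \<in> H" for i
  proof (cases "t = 1")
    case True
    then show ?thesis using run that
      by (subst measurable_cong[of _ _ "\<lambda>_. 0"]) (auto simp: RDSGDM_def)
  next
    case False
    then have "m (t - 1) \<in> borel_measurable (past M H D \<xi> m t)"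
      using t by (intro measurable_past_message) auto
    then show ?thesis
      by (rule measurable_compose) (intro borel_measurable_continuous_onI continuous_intros)
  qed
  then show ?thesis
    using measurable_past_iterate[OF run A, of "t - 1" t] t
    by (intro measurable_Pair measurable_restrict) auto
qed

end

end

lemma measurable_lyapunov:
  fixes Y :: "'a \<Rightarrow> real ^ 'd ^ 'n::finite"
  assumes smooth: "smooth L \<phi>" and Z[measurable]: "Z \<in> borel_measurable N"
    and Y: "\<And>i. i \<in> H \<Longrightarrow> (\<lambda>w. Y w $ i) \<in> borel_measurable N"
  shows "(\<lambda>w. lyapunov H \<phi> c L \<kappa> (Z w) (Y w)) \<in> borel_measurable N"
proof -
  have [measurable]: "\<phi> \<in> borel_measurable borel" "gradient \<phi> \<in> borel_measurable borel"
    using continuous_on_smooth[OF smooth] continuous_on_gradient[OF smooth]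
    by (auto intro: borel_measurable_continuous_onI)
  have [measurable]: "(\<lambda>w. avg H (Y w)) \<in> borel_measurable N"
    unfolding avg_def using Y by simp
  have [measurable]: "(\<lambda>w. spread H (Y w)) \<in> borel_measurable N"
    unfolding spread_def using Y by simp
  show ?thesis unfolding lyapunov_def by measurable
qed

text \<open>
  The stochastic half of the contraction: by freshness the state may be frozen while the samples of
  round \<open>t\<close> are averaged out.
\<close>

lemma (in prob_space) lyapunov_noise_step:
  fixes H :: "'n::finite set" and f :: "'n \<Rightarrow> real ^ 'd \<Rightarrow> real"
    and m :: "nat \<Rightarrow> 'a \<Rightarrow> real ^ 'd ^ 'n"
  assumes "H \<noteq> {}" "L > 0" "\<kappa> \<ge> 0"
    and \<phi>: "\<phi> = global_obj H f" and smooth: "smooth L \<phi>" and lower: "\<And>y. c \<le> \<phi> y"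
    and differentiable: "\<And>i y. i \<in> H \<Longrightarrow> f i differentiable (at y)"
    and dissim: "bounded_dissimilarity G B H f"
    and sfo: "stochastic_oracle M H D f g \<sigma> \<xi>"
    and fresh: "fresh_samples M H D \<xi> m"
    and run: "RDSGDM M H A g \<gamma> \<beta> x0 \<xi> x m" and A: "A \<in> borel_measurable borel"
    and t: "t \<ge> 1" and \<beta>: "0 \<le> \<beta> t" "\<beta> t \<le> 1"
  shows "(\<integral>\<^sup>+\<omega>. ennreal (lyapunov H \<phi> c L \<kappa> (x (t - 1) \<omega>) (m t \<omega>)) \<partial>M)
    \<le> (\<integral>\<^sup>+\<omega>. ennreal (drift H \<phi> c L \<kappa> G B (\<beta> t) (x (t - 1) \<omega>) (m (t - 1) \<omega>)
        + (1 - \<beta> t)\<^sup>2 * (1 / (8 * L * real (card H)) + 7 * \<kappa> / (12 * L)) * \<sigma>\<^sup>2) \<partial>M)"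
proof -
  let ?S = "borel \<Otimes>\<^sub>M (\<Pi>\<^sub>M i\<in>H. borel) :: (_ \<times> ('n \<Rightarrow> real ^ 'd)) measure"
  let ?X = "\<lambda>\<omega>. (x (t - 1) \<omega>, \<lambda>i\<in>H. m (t - 1) \<omega> $ i)"
  let ?N = "\<Pi>\<^sub>M i\<in>H. D i" and ?Y = "\<lambda>\<omega>. \<lambda>i\<in>H. \<xi> i t \<omega>"
  let ?noise = "(1 - \<beta> t)\<^sup>2 * (1 / (8 * L * real (card H)) + 7 * \<kappa> / (12 * L)) * \<sigma>\<^sup>2"
  define \<Phi> where "\<Phi> = (\<lambda>w. ennreal (lyapunov H \<phi> c L \<kappa> (fst (fst w))
      (\<chi> i. \<beta> t *\<^sub>R snd (fst w) i + (1 - \<beta> t) *\<^sub>R g i (fst (fst w)) (snd w i))))"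
  have "(\<integral>\<^sup>+\<omega>. ennreal (lyapunov H \<phi> c L \<kappa> (x (t - 1) \<omega>) (m t \<omega>)) \<partial>M) = (\<integral>\<^sup>+\<omega>. \<Phi> (?X \<omega>, ?Y \<omega>) \<partial>M)"
  proof (rule nn_integral_cong)
    fix \<omega> assume "\<omega> \<in> space M"
    then have "m t \<omega> $ i = \<beta> t *\<^sub>R (m (t - 1) \<omega> $ i) + (1 - \<beta> t) *\<^sub>R g i (x (t - 1) \<omega>) (\<xi> i t \<omega>)"
      if "i \<in> H" for i
      using run t that by (simp add: RDSGDM_def)
    then show "ennreal (lyapunov H \<phi> c L \<kappa> (x (t - 1) \<omega>) (m t \<omega>)) = \<Phi> (?X \<omega>, ?Y \<omega>)"
      unfolding \<Phi>_def fst_conv snd_conv by (intro arg_cong[of _ _ ennreal] lyapunov_cong) simp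
  qed
  also have "\<dots> \<le> (\<integral>\<^sup>+\<omega>. ennreal (drift H \<phi> c L \<kappa> G B (\<beta> t) (x (t - 1) \<omega>) (m (t - 1) \<omega>) + ?noise) \<partial>M)"
  proof (rule nn_integral_indep_le)
    show "indep_set (sets (past M H D \<xi> m t)) (sets (vimage_algebra (space M) ?Y ?N))"
      using fresh t by (simp add: fresh_samples_def past_def)
    show "?X \<in> measurable (past M H D \<xi> m t) ?S"
      by (rule measurable_past_state[OF fresh run A t])
    show "?Y \<in> measurable (vimage_algebra (space M) ?Y ?N) ?N"
      using measurable_space[OF measurable_sample[OF fresh _ t]]
      by (intro measurable_vimage_algebra1) (auto simp: space_PiM)
    have "(\<lambda>w. g i (fst (fst w)) (snd w i)) \<in> borel_measurable (?S \<Otimes>\<^sub>M ?N)" if "i \<in> H" for i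
    proof -
      have g: "(\<lambda>(x, s). g i x s) \<in> borel_measurable (borel \<Otimes>\<^sub>M D i)"
        using sfo that by (simp add: stochastic_oracle_def)
      have "(\<lambda>w. (fst (fst w), snd w i)) \<in> measurable (?S \<Otimes>\<^sub>M ?N) (borel \<Otimes>\<^sub>M D i)"
        using that by measurable
      from measurable_compose[OF this g] show ?thesis by simp
    qed
    moreover have "(\<lambda>w. snd (fst w) i) \<in> borel_measurable (?S \<Otimes>\<^sub>M ?N)" if "i \<in> H" for i
      using that by measurable
    ultimately show "\<Phi> \<in> borel_measurable (?S \<Otimes>\<^sub>M ?N)"
      unfolding \<Phi>_def by (intro measurable_compose[OF measurable_lyapunov[OF smooth] measurable_ennreal]) auto
    fix \<omega>
    define z where "z = x (t - 1) \<omega>"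
    define X where "X i \<omega>' = g i z (\<xi> i t \<omega>')" for i \<omega>'
    have X: "integrable M (X i)" "expectation (X i) = gradient (f i) z"
      "integrable M (\<lambda>\<omega>. (norm (X i \<omega> - gradient (f i) z))\<^sup>2)"
      "expectation (\<lambda>\<omega>. (norm (X i \<omega> - gradient (f i) z))\<^sup>2) \<le> \<sigma>\<^sup>2" if i: "i \<in> H" for i
    proof -
      note \<xi> = measurable_sample[OF fresh i t] and d = distr_sample[OF fresh i t]
      have g: "integrable (D i) (g i z)" "(\<integral>s. g i z s \<partial>D i) = gradient (f i) z"
        "integrable (D i) (\<lambda>s. (norm (g i z s - gradient (f i) z))\<^sup>2)"
        "(\<integral>s. (norm (g i z s - gradient (f i) z))\<^sup>2 \<partial>D i) \<le> \<sigma>\<^sup>2"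
        using sfo i by (auto simp: stochastic_oracle_def)
      note gm = borel_measurable_integrable[OF g(1)] borel_measurable_integrable[OF g(3)]
      show "integrable M (X i)" "expectation (X i) = gradient (f i) z"
        "integrable M (\<lambda>\<omega>. (norm (X i \<omega> - gradient (f i) z))\<^sup>2)"
        "expectation (\<lambda>\<omega>. (norm (X i \<omega> - gradient (f i) z))\<^sup>2) \<le> \<sigma>\<^sup>2"
        using g integrable_distr_eq[OF \<xi> gm(1)] integral_distr[OF \<xi> gm(1)]
          integrable_distr_eq[OF \<xi> gm(2)] integral_distr[OF \<xi> gm(2)]
        by (auto simp: d X_def[abs_def])
    qed
    have indep: "indep_vars (\<lambda>_. borel) X H"
      using sfo t unfolding stochastic_oracle_def X_def[abs_def] by blast
    have grad: "gradient \<phi> z = (1 / real (card H)) *\<^sub>R (\<Sum>i\<in>H. gradient (f i) z)"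
      unfolding \<phi> using differentiable by (rule gradient_global_obj)
    have "\<Phi> (?X \<omega>, ?Y \<omega>')
        = ennreal (lyapunov H \<phi> c L \<kappa> z (\<chi> i. \<beta> t *\<^sub>R (m (t - 1) \<omega> $ i) + (1 - \<beta> t) *\<^sub>R X i \<omega>'))" for \<omega>'
      unfolding \<Phi>_def fst_conv snd_conv z_def X_def by (intro arg_cong[of _ _ ennreal] lyapunov_cong) simp
    then have "(\<integral>\<^sup>+\<omega>'. \<Phi> (?X \<omega>, ?Y \<omega>') \<partial>M) =
        (\<integral>\<^sup>+\<omega>'. ennreal (lyapunov H \<phi> c L \<kappa> z (\<chi> i. \<beta> t *\<^sub>R (m (t - 1) \<omega> $ i) + (1 - \<beta> t) *\<^sub>R X i \<omega>')) \<partial>M)"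
      by simp
    also have "\<dots> \<le> ennreal (drift H \<phi> c L \<kappa> G B (\<beta> t) z (m (t - 1) \<omega>) + ?noise)"
    proof -
      have "(1 / real (card H)) * (\<Sum>i\<in>H. (norm (gradient (f i) z - gradient \<phi> z))\<^sup>2)
          \<le> G\<^sup>2 + B\<^sup>2 * (norm (gradient \<phi> z))\<^sup>2"
        using dissim by (simp add: bounded_dissimilarity_def \<phi>)
      with X(2) have "(1 / real (card H)) * (\<Sum>i\<in>H. (norm (expectation (X i) - gradient \<phi> z))\<^sup>2)
          \<le> G\<^sup>2 + B\<^sup>2 * (norm (gradient \<phi> z))\<^sup>2" by simp
      with X indep grad show ?thesis
        by (intro expected_lyapunov_le assms(1-3) lower \<beta>) simp_all
    qed
    finally show "(\<integral>\<^sup>+\<omega>'. \<Phi> (?X \<omega>, ?Y \<omega>') \<partial>M)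
        \<le> ennreal (drift H \<phi> c L \<kappa> G B (\<beta> t) (x (t - 1) \<omega>) (m (t - 1) \<omega>) + ?noise)"
      by (simp add: z_def)
  qed simp_all
  finally show ?thesis .
qed

section \<open>Convergence\<close>

theorem theoremB8:
  fixes M :: "'w measure"
    and H :: "'n::finite set" and b T :: nat
    and D :: "'n \<Rightarrow> 's measure" and l :: "real ^ 'd \<Rightarrow> 's \<Rightarrow> real"
    and f :: "'n \<Rightarrow> real ^ 'd \<Rightarrow> real" and fH :: "real ^ 'd \<Rightarrow> real" and fstar :: real
    and g :: "'n \<Rightarrow> real ^ 'd \<Rightarrow> 's \<Rightarrow> real ^ 'd"
    and A :: "real ^ 'd ^ 'n \<Rightarrow> real ^ 'd"
    and \<xi> :: "'n \<Rightarrow> nat \<Rightarrow> 'w \<Rightarrow> 's"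
    and x :: "nat \<Rightarrow> 'w \<Rightarrow> real ^ 'd" and m :: "nat \<Rightarrow> 'w \<Rightarrow> real ^ 'd ^ 'n"
    and x0 :: "real ^ 'd"
    and \<gamma> \<beta> :: "nat \<Rightarrow> real"
    and L \<mu> G B \<sigma> \<kappa> \<alpha>4 \<alpha>5 \<alpha>6 s0 \<gamma>0 :: real
  assumes "prob_space M"
    and "real b < real CARD('n) / 2" and "card H = CARD('n) - b"
    and "\<And>i. i \<in> H \<Longrightarrow> prob_space (D i)"
    and "\<And>i x. i \<in> H \<Longrightarrow> integrable (D i) (l x)"
    and "f = local_obj D l" and "\<And>i x. i \<in> H \<Longrightarrow> f i differentiable (at x)"
    and "fH = global_obj H f"
    and "bdd_below (range fH)" and "fstar = (INF x. fH x)"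
    and "L > 0" and "smooth L fH"
    and "\<mu> > 0" and "PL_condition \<mu> fH"
    and "G \<ge> 0" and "B \<ge> 0" and "bounded_dissimilarity G B H f"
    and "stochastic_oracle M H D f g \<sigma> \<xi>"
    and "\<kappa> > 0" and "robust_aggregation b \<kappa> A" and "A \<in> borel_measurable borel"
    and "\<kappa> * B\<^sup>2 < 1 / 56"
    and "\<alpha>4 = (3 / 8 - 21 * \<kappa> * B\<^sup>2) * \<mu>"
    and "\<alpha>5 = (162 * L / real (card H) + 756 * \<kappa> * L) * \<sigma>\<^sup>2"
    and "\<alpha>6 = 21 * \<kappa> * G\<^sup>2"
    and "T > 0"
    and "s0 > max 2 (72 * L / \<alpha>4)"
    and "\<gamma>0 = 2 / (\<alpha>4 * s0)" and "\<gamma>0 < min (1 / \<alpha>4) (1 / (36 * L))"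
    and "\<And>t. t \<ge> 1 \<Longrightarrow>
           \<gamma> t = (if t < T div 2 then \<gamma>0 else 2 / (\<alpha>4 * (s0 + real t - real (T div 2))))"
    and "\<And>t. t \<ge> 1 \<Longrightarrow> \<beta> t = 1 - 36 * \<gamma> t * L"
    and "fresh_samples M H D \<xi> m"
    and "RDSGDM M H A g \<gamma> \<beta> x0 \<xi> x m"
  shows "integrable M (\<lambda>\<omega>. fH (x (T - 1) \<omega>) - fstar) \<and>
         (\<integral>\<omega>. (fH (x (T - 1) \<omega>) - fstar) \<partial>M)
           \<le> (s0 - 1)\<^sup>2 * (fH x0 - fstar)
                * (2 * exp (- \<alpha>4 * \<gamma>0 * (real (T div 2) - 1)) / (real T)\<^sup>2)
             + 2 * (\<alpha>5 * \<gamma>0 + \<alpha>6) * (s0 - 1)\<^sup>2 / (\<alpha>4 * (real T)\<^sup>2)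
             + 4 * \<alpha>5 / (\<alpha>4\<^sup>2 * real T)
             + \<alpha>6 / \<alpha>4"
proof -
  interpret prob_space M by fact
  note smooth = \<open>smooth L fH\<close> and fH = \<open>fH = global_obj H f\<close>
    and kB = \<open>\<kappa> * B\<^sup>2 < 1 / 56\<close> and \<gamma>0 = \<open>\<gamma>0 = 2 / (\<alpha>4 * s0)\<close>
    and fresh = \<open>fresh_samples M H D \<xi> m\<close> and run = \<open>RDSGDM M H A g \<gamma> \<beta> x0 \<xi> x m\<close>
    and A = \<open>A \<in> borel_measurable borel\<close>
  have \<gamma>: "\<gamma> t = (if t < T div 2 then \<gamma>0 else 2 / (\<alpha>4 * (s0 + real t - real (T div 2))))"
    if "t \<ge> 1" for t
    using that assms(30) by blast
  have \<beta>: "\<beta> t = 1 - 36 * \<gamma> t * L" if "t \<ge> 1" for t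
    using that assms(31) by blast
  have "card H > 0" using assms(2,3) by (simp add: less_diff_conv)
  then have "H \<noteq> {}" by auto
  have lower: "fstar \<le> fH y" for y
    unfolding \<open>fstar = (INF x. fH x)\<close> using \<open>bdd_below (range fH)\<close> by (intro cINF_lower) auto
  have PL: "2 * \<mu> * (fH y - fstar) \<le> (norm (gradient fH y))\<^sup>2" for y
    using \<open>PL_condition \<mu> fH\<close> \<open>fstar = (INF x. fH x)\<close> by (simp add: PL_condition_def)
  have x0: "x 0 \<omega> = x0" "i \<in> H \<Longrightarrow> m 0 \<omega> $ i = 0" if "\<omega> \<in> space M" for \<omega> i
    using run that by (simp_all add: RDSGDM_def)
  define F0 where "F0 = fH x0 - fstar"
  have "F0 \<ge> 0" using lower by (simp add: F0_def)
  have "\<alpha>4 > 0"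
    using \<open>\<alpha>4 = _\<close> kB \<open>\<mu> > 0\<close> by simp
  have "\<alpha>5 \<ge> 0" "\<alpha>6 \<ge> 0"
    using \<open>\<alpha>5 = _\<close> \<open>\<alpha>6 = _\<close> \<open>L > 0\<close> \<open>\<kappa> > 0\<close> by simp_all
  have "s0 > 2" using \<open>s0 > max 2 _\<close> by simp
  have "\<gamma>0 > 0" unfolding \<gamma>0 using \<open>s0 > 2\<close> \<open>\<alpha>4 > 0\<close> by simp
  define bound where "bound = (s0 - 1)\<^sup>2 * (fH x0 - fstar)
                * (2 * exp (- \<alpha>4 * \<gamma>0 * (real (T div 2) - 1)) / (real T)\<^sup>2)
             + 2 * (\<alpha>5 * \<gamma>0 + \<alpha>6) * (s0 - 1)\<^sup>2 / (\<alpha>4 * (real T)\<^sup>2)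
             + 4 * \<alpha>5 / (\<alpha>4\<^sup>2 * real T)
             + \<alpha>6 / \<alpha>4"
  have terms_nonneg: "0 \<le> 2 * (\<alpha>5 * \<gamma>0 + \<alpha>6) * (s0 - 1)\<^sup>2 / (\<alpha>4 * (real T)\<^sup>2)"
    "0 \<le> 4 * \<alpha>5 / (\<alpha>4\<^sup>2 * real T)" "0 \<le> \<alpha>6 / \<alpha>4"
    using \<open>\<alpha>4 > 0\<close> \<open>\<alpha>5 \<ge> 0\<close> \<open>\<alpha>6 \<ge> 0\<close> \<open>\<gamma>0 > 0\<close> by simp_all
  have "0 \<le> (s0 - 1)\<^sup>2 * (fH x0 - fstar)
                * (2 * exp (- \<alpha>4 * \<gamma>0 * (real (T div 2) - 1)) / (real T)\<^sup>2)"
    using \<open>F0 \<ge> 0\<close> unfolding F0_def by (intro mult_nonneg_nonneg divide_nonneg_nonneg) auto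
  with terms_nonneg have "0 \<le> bound" unfolding bound_def by linarith
  \<comment> \<open>The contraction needs \<open>\<mu> \<le> L\<close>, which follows from PL and smoothness unless the objective is
    constant. For \<open>T = 1\<close> the iterate is still \<open>x0\<close>.\<close>
  consider (const) "\<And>y. fH y = fstar" | (one) "T = 1"
    | (main) "T \<ge> 2" "\<mu> \<le> L"
  proof (cases "\<forall>y. fH y = fstar")
    case False
    then obtain y where "fH y - fstar > 0" using lower by (metis antisym_conv2 diff_gt_0_iff_gt)
    moreover have "2 * \<mu> * (fH y - fstar) \<le> 2 * L * (fH y - fstar)"
      using PL smooth_gradient_bound[OF smooth \<open>L > 0\<close> lower] by (rule order_trans)
    ultimately have "\<mu> \<le> L" by simp
    then show ?thesis using main one \<open>T > 0\<close> by linarith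
  qed (use const in blast)
  then have "integrable M (\<lambda>\<omega>. fH (x (T - 1) \<omega>) - fstar) \<and>
      (\<integral>\<omega>. (fH (x (T - 1) \<omega>) - fstar) \<partial>M) \<le> bound"
  proof cases
    case const
    then show ?thesis using \<open>0 \<le> bound\<close> by simp
  next
    case one
    have "F0 * 1 \<le> F0 * ((s0 - 1)\<^sup>2 * (2 * exp (\<alpha>4 * \<gamma>0)))"
    proof (intro mult_left_mono \<open>F0 \<ge> 0\<close>)
      have "1 \<le> (s0 - 1)\<^sup>2" using \<open>s0 > 2\<close> by (intro one_le_power) simp
      moreover have "1 + \<alpha>4 * \<gamma>0 \<le> exp (\<alpha>4 * \<gamma>0)" by (rule exp_ge_add_one_self)
      then have "1 \<le> 2 * exp (\<alpha>4 * \<gamma>0)"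
        using mult_pos_pos[OF \<open>\<alpha>4 > 0\<close> \<open>\<gamma>0 > 0\<close>] by linarith
      ultimately have "1 * 1 \<le> (s0 - 1)\<^sup>2 * (2 * exp (\<alpha>4 * \<gamma>0))"
        by (rule mult_mono) simp_all
      then show "1 \<le> (s0 - 1)\<^sup>2 * (2 * exp (\<alpha>4 * \<gamma>0))" by simp
    qed
    also have "\<dots> = (s0 - 1)\<^sup>2 * (fH x0 - fstar)
                * (2 * exp (- \<alpha>4 * \<gamma>0 * (real (T div 2) - 1)) / (real T)\<^sup>2)"
      by (simp add: one F0_def)
    finally have "F0 \<le> bound" using terms_nonneg unfolding bound_def by linarith
    moreover have "integrable M (\<lambda>\<omega>. fH (x (T - 1) \<omega>) - fstar) \<longleftrightarrow> integrable M (\<lambda>\<omega>. F0)"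
      using x0 by (intro Bochner_Integration.integrable_cong) (auto simp: one F0_def)
    moreover have "(\<integral>\<omega>. (fH (x (T - 1) \<omega>) - fstar) \<partial>M) = (\<integral>\<omega>. F0 \<partial>M)"
      using x0 by (intro Bochner_Integration.integral_cong) (auto simp: one F0_def)
    ultimately show ?thesis by (simp add: prob_space)
  next
    case main
    have "\<alpha>4 \<le> 3 / 8 * L"
      unfolding \<open>\<alpha>4 = _\<close> using \<open>\<kappa> > 0\<close> \<open>\<mu> > 0\<close> \<open>\<mu> \<le> L\<close> by (intro mult_mono) auto
    have "s0 \<ge> 4"
    proof -
      have "4 \<le> 72 * L / \<alpha>4" using \<open>\<alpha>4 \<le> 3 / 8 * L\<close> \<open>\<alpha>4 > 0\<close> \<open>L > 0\<close> by (simp add: field_simps)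
      then show ?thesis using \<open>s0 > max 2 _\<close> by simp
    qed
    have step: "0 < \<gamma> t" "36 * L * \<gamma> t \<le> 1" "\<gamma> (Suc t) \<le> \<gamma> t" "2 / 3 * \<gamma> t \<le> \<gamma> (Suc t)"
      if "t \<ge> 1" for t
    proof -
      define s where "s t = s0 + real (t - T div 2)" for t
      have \<gamma>s: "\<gamma> t = 2 / \<alpha>4 * (1 / s t)" if "t \<ge> 1" for t
        using \<gamma>[OF that] by (simp add: s_def \<gamma>0 of_nat_diff)
      have s: "s t \<ge> s0" "s t \<le> s (Suc t)" "s (Suc t) \<le> s t + 1" for t by (auto simp: s_def)
      have s_pos: "s t > 0" "2 * s (Suc t) \<le> 3 * s t" for t
        using s(1)[of t] s(3)[of t] \<open>s0 > 2\<close> by simp_all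
      show "0 < \<gamma> t" using \<gamma>s[OF that] s_pos \<open>\<alpha>4 > 0\<close> by simp
      show "\<gamma> (Suc t) \<le> \<gamma> t"
        using \<gamma>s that s_pos[of t] s_pos[of "Suc t"] s(2)[of t] \<open>\<alpha>4 > 0\<close> by (simp add: divide_left_mono)
      have "2 / 3 * (1 / s t) \<le> 1 / s (Suc t)"
        using s_pos[of t] s_pos(1)[of "Suc t"] by (simp add: field_simps)
      then have "2 / \<alpha>4 * (2 / 3 * (1 / s t)) \<le> 2 / \<alpha>4 * (1 / s (Suc t))"
        using \<open>\<alpha>4 > 0\<close> by (intro mult_left_mono) auto
      then show "2 / 3 * \<gamma> t \<le> \<gamma> (Suc t)" using \<gamma>s that by simp
      have "2 / \<alpha>4 * (1 / s t) \<le> 2 / \<alpha>4 * (1 / s0)"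
        using s(1)[of t] \<open>s0 > 2\<close> \<open>\<alpha>4 > 0\<close> by (intro mult_left_mono divide_left_mono) auto
      then have "\<gamma> t \<le> \<gamma>0" using \<gamma>s[OF that] by (simp add: \<gamma>0)
      then have "36 * L * \<gamma> t \<le> 36 * L * \<gamma>0" using \<open>L > 0\<close> by simp
      also have "\<dots> \<le> 1" using \<open>\<gamma>0 < min _ _\<close> \<open>L > 0\<close> by (simp add: field_simps)
      finally show "36 * L * \<gamma> t \<le> 1" .
    qed
    have \<gamma>1: "\<gamma> 1 = \<gamma>0"
      using \<gamma>[of 1] \<open>T \<ge> 2\<close> div_le_mono[of 2 T 2] by (cases "T div 2 = 1") (auto simp: \<gamma>0)
    define V where "V t \<omega> = lyapunov H fH fstar L \<kappa> (x (t - 1) \<omega>) (m t \<omega>)" for t \<omega>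
    \<comment> \<open>As an extended nonnegative number \<open>E t\<close> exists before any integrability is known; its
      finiteness comes out of the recursion.\<close>
    define E where "E t = (\<integral>\<^sup>+\<omega>. ennreal (V t \<omega>) \<partial>M)" for t
    have V_nonneg: "0 \<le> V t \<omega>" for t \<omega>
      unfolding V_def using lower \<open>L > 0\<close> \<open>\<kappa> > 0\<close> by (intro lyapunov_nonneg) auto
    have V_meas: "V t \<in> borel_measurable M" if "t \<ge> 1" for t
    proof -
      have "(\<lambda>\<omega>. m t \<omega> $ i) \<in> borel_measurable M" for i
        by (rule measurable_compose[OF measurable_message[OF fresh that]])
          (intro borel_measurable_continuous_onI continuous_intros)
      then show ?thesis unfolding V_def[abs_def]
        by (intro measurable_lyapunov[OF smooth] measurable_iterate[OF fresh run A])
    qed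
    have E_le: "E t \<le> (\<integral>\<^sup>+\<omega>. ennreal (drift H fH fstar L \<kappa> G B (1 - 36 * \<gamma> t * L) (x (t - 1) \<omega>) (m (t - 1) \<omega>)
        + \<alpha>5 * (\<gamma> t)\<^sup>2) \<partial>M)" if "t \<ge> 1" for t
    proof -
      have "(1 - \<beta> t)\<^sup>2 * (1 / (8 * L * real (card H)) + 7 * \<kappa> / (12 * L)) * \<sigma>\<^sup>2 = \<alpha>5 * (\<gamma> t)\<^sup>2"
        unfolding \<beta>[OF that] \<open>\<alpha>5 = _\<close> using \<open>L > 0\<close> \<open>card H > 0\<close>
        by (simp add: field_simps power2_eq_square)
      moreover have "0 \<le> \<beta> t" "\<beta> t \<le> 1"
        using step(1,2)[OF that] \<open>L > 0\<close> by (simp_all add: \<beta>[OF that] mult_ac)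
      ultimately show ?thesis
        using lyapunov_noise_step[OF \<open>H \<noteq> {}\<close> \<open>L > 0\<close> less_imp_le[OF \<open>\<kappa> > 0\<close>] fH smooth lower
            assms(7) \<open>bounded_dissimilarity G B H f\<close> \<open>stochastic_oracle M H D f g \<sigma> \<xi>\<close> fresh run A that]
        by (simp add: E_def V_def \<beta>[OF that])
    qed
    have init: "E 1 \<le> ennreal (5 / 4 * F0 + \<alpha>6 * \<gamma>0 + \<alpha>5 * \<gamma>0\<^sup>2)"
    proof -
      have "E 1 \<le> (\<integral>\<^sup>+\<omega>. ennreal (5 / 4 * F0 + \<alpha>6 * \<gamma>0 + \<alpha>5 * \<gamma>0\<^sup>2) \<partial>M)"
      proof (rule order_trans[OF E_le nn_integral_mono])
        fix \<omega> assume \<omega>: "\<omega> \<in> space M"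
        have "drift H fH fstar L \<kappa> G B (1 - 36 * \<gamma> 1 * L) (x 0 \<omega>) (m 0 \<omega>)
            \<le> 5 / 4 * F0 + 21 * \<kappa> * G\<^sup>2 * \<gamma> 1"
          using drift_initial[OF smooth \<open>L > 0\<close> lower \<open>\<kappa> > 0\<close> kB step(1,2)[of 1] x0(2)[OF \<omega>]] x0(1)[OF \<omega>]
          by (simp add: F0_def)
        then show "ennreal (drift H fH fstar L \<kappa> G B (1 - 36 * \<gamma> 1 * L) (x (1 - 1) \<omega>) (m (1 - 1) \<omega>)
            + \<alpha>5 * (\<gamma> 1)\<^sup>2) \<le> ennreal (5 / 4 * F0 + \<alpha>6 * \<gamma>0 + \<alpha>5 * \<gamma>0\<^sup>2)"
          by (intro ennreal_leI) (simp add: \<gamma>1[unfolded One_nat_def] \<open>\<alpha>6 = _\<close>)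
      qed simp
      then show ?thesis by (simp add: emeasure_space_1)
    qed
    have rec: "E (Suc t) \<le> ennreal (1 - 2 * \<alpha>4 * \<gamma> t) * E t + ennreal (\<alpha>6 * \<gamma> t + \<alpha>5 * (\<gamma> t)\<^sup>2)"
      and contr: "0 \<le> 1 - 2 * \<alpha>4 * \<gamma> t"
      if t: "t \<ge> 1" for t
    proof -
      note st = step[OF t]
      have "2 * \<alpha>4 * \<gamma> t \<le> 36 * L * \<gamma> t"
        using \<open>\<alpha>4 \<le> 3 / 8 * L\<close> \<open>L > 0\<close> st(1) by (intro mult_right_mono) auto
      then show contr: "0 \<le> 1 - 2 * \<alpha>4 * \<gamma> t" using st(2) by simp
      have "E (Suc t) \<le> (\<integral>\<^sup>+\<omega>. ennreal (1 - 2 * \<alpha>4 * \<gamma> t) * ennreal (V t \<omega>)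
          + ennreal (\<alpha>6 * \<gamma> t + \<alpha>5 * (\<gamma> t)\<^sup>2) \<partial>M)"
      proof (rule order_trans[OF E_le nn_integral_mono])
        fix \<omega> assume \<omega>: "\<omega> \<in> space M"
        have "x t \<omega> = x (t - 1) \<omega> - \<gamma> t *\<^sub>R A (m t \<omega>)"
          using run \<omega> t by (simp add: RDSGDM_def)
        then have "drift H fH fstar L \<kappa> G B (1 - 36 * \<gamma> (Suc t) * L) (x t \<omega>) (m t \<omega>)
            \<le> (1 - 2 * \<alpha>4 * \<gamma> t) * V t \<omega> + 21 * \<kappa> * G\<^sup>2 * \<gamma> (Suc t)"
          unfolding V_def
          using drift_step[OF smooth \<open>L > 0\<close> PL lower \<open>\<mu> > 0\<close> \<open>\<mu> \<le> L\<close> \<open>\<kappa> > 0\<close>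
              \<open>robust_aggregation b \<kappa> A\<close> \<open>card H = _\<close> kB \<open>\<alpha>4 = _\<close> st] by simp
        moreover have "21 * \<kappa> * G\<^sup>2 * \<gamma> (Suc t) \<le> \<alpha>6 * \<gamma> t"
          unfolding \<open>\<alpha>6 = _\<close> using st(3) \<open>\<kappa> > 0\<close> by (intro mult_left_mono) auto
        moreover have "\<alpha>5 * (\<gamma> (Suc t))\<^sup>2 \<le> \<alpha>5 * (\<gamma> t)\<^sup>2"
          using st(3) step(1)[of "Suc t"] \<open>\<alpha>5 \<ge> 0\<close> by (intro mult_left_mono power_mono) auto
        ultimately have "drift H fH fstar L \<kappa> G B (1 - 36 * \<gamma> (Suc t) * L) (x t \<omega>) (m t \<omega>)
            + \<alpha>5 * (\<gamma> (Suc t))\<^sup>2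
            \<le> (1 - 2 * \<alpha>4 * \<gamma> t) * V t \<omega> + (\<alpha>6 * \<gamma> t + \<alpha>5 * (\<gamma> t)\<^sup>2)" by linarith
        then have "ennreal (drift H fH fstar L \<kappa> G B (1 - 36 * \<gamma> (Suc t) * L) (x t \<omega>) (m t \<omega>)
            + \<alpha>5 * (\<gamma> (Suc t))\<^sup>2)
            \<le> ennreal ((1 - 2 * \<alpha>4 * \<gamma> t) * V t \<omega> + (\<alpha>6 * \<gamma> t + \<alpha>5 * (\<gamma> t)\<^sup>2))" by (rule ennreal_leI)
        also have "\<dots> = ennreal (1 - 2 * \<alpha>4 * \<gamma> t) * ennreal (V t \<omega>) + ennreal (\<alpha>6 * \<gamma> t + \<alpha>5 * (\<gamma> t)\<^sup>2)"
          using contr V_nonneg \<open>\<alpha>5 \<ge> 0\<close> \<open>\<alpha>6 \<ge> 0\<close> st(1)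
          by (subst ennreal_plus) (auto simp: ennreal_mult)
        finally show "ennreal (drift H fH fstar L \<kappa> G B (1 - 36 * \<gamma> (Suc t) * L) (x (Suc t - 1) \<omega>) (m (Suc t - 1) \<omega>)
            + \<alpha>5 * (\<gamma> (Suc t))\<^sup>2)
            \<le> ennreal (1 - 2 * \<alpha>4 * \<gamma> t) * ennreal (V t \<omega>) + ennreal (\<alpha>6 * \<gamma> t + \<alpha>5 * (\<gamma> t)\<^sup>2)"
          by simp
      qed simp
      also have "\<dots> = ennreal (1 - 2 * \<alpha>4 * \<gamma> t) * E t + ennreal (\<alpha>6 * \<gamma> t + \<alpha>5 * (\<gamma> t)\<^sup>2)"
        unfolding E_def using V_meas[OF t]
        by (simp add: nn_integral_add nn_integral_cmult emeasure_space_1)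
      finally show "E (Suc t) \<le> ennreal (1 - 2 * \<alpha>4 * \<gamma> t) * E t + ennreal (\<alpha>6 * \<gamma> t + \<alpha>5 * (\<gamma> t)\<^sup>2)" .
    qed
    define a where "a t = enn2real (E t)" for t
    have E_fin: "E t < \<top>" if "t \<ge> 1" for t
      using that
    proof (induction t rule: dec_induct)
      case base
      show ?case using init by (rule le_less_trans) simp
    next
      case (step t)
      show ?case using rec[OF step(1)] step(3)
        by (elim le_less_trans) (simp add: ennreal_mult_less_top)
    qed
    then have E_eq: "E t = ennreal (a t)" if "t \<ge> 1" for t
      using that by (simp add: a_def)
    have a_nonneg: "0 \<le> a t" for t by (simp add: a_def)
    have "a T \<le> bound"
      unfolding bound_def F0_def[symmetric]
    proof (rule two_phase_recursion_bound[OF \<open>T \<ge> 2\<close> \<open>\<alpha>4 > 0\<close> \<open>s0 \<ge> 4\<close> \<open>\<alpha>5 \<ge> 0\<close> \<open>\<alpha>6 \<ge> 0\<close> \<open>F0 \<ge> 0\<close> \<gamma>0 \<gamma>])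
      show "a 1 \<le> 5 / 4 * F0 + \<alpha>6 * \<gamma>0 + \<alpha>5 * \<gamma>0\<^sup>2"
        unfolding a_def using init \<open>F0 \<ge> 0\<close> \<open>\<alpha>5 \<ge> 0\<close> \<open>\<alpha>6 \<ge> 0\<close> \<open>\<gamma>0 > 0\<close> by (intro enn2real_leI) auto
    next
      fix t :: nat assume t: "t \<ge> 1"
      have nn: "0 \<le> \<alpha>6 * \<gamma> t + \<alpha>5 * (\<gamma> t)\<^sup>2"
        using \<open>\<alpha>5 \<ge> 0\<close> \<open>\<alpha>6 \<ge> 0\<close> step(1)[OF t] by simp
      have "E (Suc t) \<le> ennreal ((1 - 2 * \<alpha>4 * \<gamma> t) * a t + (\<alpha>6 * \<gamma> t + \<alpha>5 * (\<gamma> t)\<^sup>2))"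
        using rec[OF t] contr[OF t] a_nonneg nn by (simp add: E_eq[OF t] ennreal_mult ennreal_plus)
      then have "a (Suc t) \<le> (1 - 2 * \<alpha>4 * \<gamma> t) * a t + (\<alpha>6 * \<gamma> t + \<alpha>5 * (\<gamma> t)\<^sup>2)"
        unfolding a_def[of "Suc t"] using contr[OF t] a_nonneg nn by (intro enn2real_leI) auto
      then show "a (Suc t) \<le> (1 - 2 * \<alpha>4 * \<gamma> t) * a t + \<alpha>6 * \<gamma> t + \<alpha>5 * (\<gamma> t)\<^sup>2" by simp
    qed
    have "fH \<in> borel_measurable borel"
      using continuous_on_smooth[OF smooth] by (rule borel_measurable_continuous_onI)
    from measurable_compose[OF measurable_iterate[OF fresh run A] this]
    have F_meas: "(\<lambda>\<omega>. fH (x (T - 1) \<omega>) - fstar) \<in> borel_measurable M" by simp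
    have "(\<integral>\<^sup>+\<omega>. ennreal (fH (x (T - 1) \<omega>) - fstar) \<partial>M) \<le> E T"
      unfolding E_def V_def lyapunov_def using \<open>L > 0\<close> \<open>\<kappa> > 0\<close>
      by (intro nn_integral_mono ennreal_leI) (simp add: spread_nonneg)
    also have "\<dots> \<le> ennreal bound" using E_eq[of T] \<open>T \<ge> 2\<close> \<open>a T \<le> bound\<close> by (simp add: ennreal_leI)
    finally have le: "(\<integral>\<^sup>+\<omega>. ennreal (fH (x (T - 1) \<omega>) - fstar) \<partial>M) \<le> ennreal bound" .
    have "integrable M (\<lambda>\<omega>. fH (x (T - 1) \<omega>) - fstar)"
      using F_meas lower le by (intro integrableI_nonneg) (auto intro: le_less_trans)
    moreover have "(\<integral>\<omega>. (fH (x (T - 1) \<omega>) - fstar) \<partial>M) \<le> bound"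
      using F_meas lower le \<open>0 \<le> bound\<close> by (subst integral_eq_nn_integral) (auto intro: enn2real_leI)
    ultimately show ?thesis ..
  qed
  then show ?thesis unfolding bound_def .
qed

end
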